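(* For any class $\mathbf F\subseteq\mathbf H_{un}$ of frames, the logic $\mathsf L(\mathbf F)$ has unitary unification.
   Context: A frame is a finite poset with a least element (root). For a class $\mathbf F$ of frames, $\mathsf L(\mathbf F)$ is the set of intuitionistic formulas valid in every Kripke model over every frame in $\mathbf F$. $\mathfrak L_d$ ($d\ge1$) is the $d$-element chain. For $n\ge2$, the $n$-fork $\mathfrak F_n$ is a root with $n$ pairwise incomparable maximal elements above it; $\mathfrak F_0=\mathfrak L_1$, $\mathfrak F_1=\mathfrak L_2$. For disjoint frames $\mathfrak F=(W,\le_W,w_0)$, $\mathfrak G=(U,\le_U,u_0)$, the join $\mathfrak F+\mathfrak G$ is $W\cup U$ with root $w_0$ and $x\le y$ iff $x\le_W y$ or $x\le_U y$ or ($x\in W$ and $y\in U$) (defined up to isomorphism); $\mathfrak F+$ denotes $\mathfrak F+\mathfrak L_1$ (adding a top). The $n$-rhombus is $\mathfrak R_n=\mathfrak F_n+$ (so $\mathfrak R_0=\mathfrak L_1$ up to the convention). $\mathbf H_{un}$ is the class of all frames $\mathfrak L_d+\mathfrak R_m$ with $d,m\ge0$, where $\mathfrak L_0+\mathfrak R_m$ means $\mathfrak R_m$. Unification in a logic $\mathsf L$ is unitary if every $\mathsf L$-unifiable formula $A$ has a unifier $\varepsilon$ (a substitution with $\varepsilon(A)\in\mathsf L$) that is more general than every unifier $\mu$ of $A$, i.e. $\alpha\circ\varepsilon=_{\mathsf L}\mu$ for some substitution $\alpha$. *)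

theory Defs
  imports Main
begin

datatype fm = Var nat | Bot | And fm fm | Or fm fm | Imp fm fm

definition Iff :: "fm \<Rightarrow> fm \<Rightarrow> fm" where
  "Iff A B = And (Imp A B) (Imp B A)"

type_synonym substitution = "nat \<Rightarrow> fm"

primrec subst :: "substitution \<Rightarrow> fm \<Rightarrow> fm" where
  "subst s (Var p) = s p"
| "subst s Bot = Bot"
| "subst s (And A B) = And (subst s A) (subst s B)"
| "subst s (Or A B) = Or (subst s A) (subst s B)"
| "subst s (Imp A B) = Imp (subst s A) (subst s B)"

definition subst_comp :: "substitution \<Rightarrow> substitution \<Rightarrow> substitution" where
  "subst_comp a e = (\<lambda>p. subst a (e p))"


record 'w frame =
  worlds :: "'w set"
  acc :: "'w rel"

definition is_frame :: "'w frame \<Rightarrow> bool" where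
  "is_frame F \<longleftrightarrow> finite (worlds F) \<and> partial_order_on (worlds F) (acc F) \<and>
     (\<exists>r\<in>worlds F. \<forall>x\<in>worlds F. (r, x) \<in> acc F)"

definition valuation_on :: "'w frame \<Rightarrow> (nat \<Rightarrow> 'w set) \<Rightarrow> bool" where
  "valuation_on F V \<longleftrightarrow>
     (\<forall>p. V p \<subseteq> worlds F \<and> (\<forall>x y. x \<in> V p \<and> (x, y) \<in> acc F \<longrightarrow> y \<in> V p))"

primrec forces :: "'w frame \<Rightarrow> (nat \<Rightarrow> 'w set) \<Rightarrow> 'w \<Rightarrow> fm \<Rightarrow> bool" where
  "forces F V x (Var p) \<longleftrightarrow> x \<in> V p"
| "forces F V x Bot \<longleftrightarrow> False"
| "forces F V x (And A B) \<longleftrightarrow> forces F V x A \<and> forces F V x B"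
| "forces F V x (Or A B) \<longleftrightarrow> forces F V x A \<or> forces F V x B"
| "forces F V x (Imp A B) \<longleftrightarrow>
     (\<forall>y. (x, y) \<in> acc F \<longrightarrow> forces F V y A \<longrightarrow> forces F V y B)"

definition logic :: "'w frame set \<Rightarrow> fm set" where
  "logic \<F> = {A. \<forall>F\<in>\<F>. \<forall>V. valuation_on F V \<longrightarrow> (\<forall>x\<in>worlds F. forces F V x A)}"


definition frame_iso :: "'w frame \<Rightarrow> 'u frame \<Rightarrow> bool" where
  "frame_iso F G \<longleftrightarrow> (\<exists>f. bij_betw f (worlds F) (worlds G) \<and>
     (\<forall>x\<in>worlds F. \<forall>y\<in>worlds F. (x, y) \<in> acc F \<longleftrightarrow> (f x, f y) \<in> acc G))"

definition relabel :: "('w \<Rightarrow> 'u) \<Rightarrow> 'w frame \<Rightarrow> 'u frame" where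
  "relabel f F = \<lparr>worlds = f ` worlds F, acc = map_prod f f ` acc F\<rparr>"

definition chain :: "nat \<Rightarrow> nat frame" where
  "chain d = \<lparr>worlds = {..<d}, acc = {(i, j). i \<le> j \<and> j < d}\<rparr>"

definition fork :: "nat \<Rightarrow> nat frame" where
  "fork n = \<lparr>worlds = {..n}, acc = {(i, j). i \<le> n \<and> j \<le> n \<and> (i = j \<or> i = 0)}\<rparr>"

definition join :: "'w frame \<Rightarrow> 'u frame \<Rightarrow> ('w + 'u) frame" where
  "join F G = \<lparr>worlds = worlds F <+> worlds G,
     acc = map_prod Inl Inl ` acc F \<union> map_prod Inr Inr ` acc G
         \<union> Inl ` worlds F \<times> Inr ` worlds G\<rparr>"

text \<open>The rhombus for \<open>n = 0\<close> is by convention the one-element chain, not the two-element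
  chain that adding a top to \<open>fork 0\<close> would give; it is relabelled only to fit the sum type.\<close>

definition rhombus :: "nat \<Rightarrow> (nat + nat) frame" where
  "rhombus n = (if n = 0 then relabel Inl (chain 1) else join (fork n) (chain 1))"

definition H_un :: "'w frame set" where
  "H_un = {F. is_frame F \<and>
     (\<exists>m. frame_iso F (rhombus m) \<or> (\<exists>d\<ge>1. frame_iso F (join (chain d) (rhombus m))))}"


definition subst_eq :: "fm set \<Rightarrow> substitution \<Rightarrow> substitution \<Rightarrow> bool" where
  "subst_eq L s t \<longleftrightarrow> (\<forall>p. Iff (s p) (t p) \<in> L)"

definition more_general :: "fm set \<Rightarrow> substitution \<Rightarrow> substitution \<Rightarrow> bool" where
  "more_general L e m \<longleftrightarrow> (\<exists>a. subst_eq L (subst_comp a e) m)"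

definition unifier :: "fm set \<Rightarrow> fm \<Rightarrow> substitution \<Rightarrow> bool" where
  "unifier L A e \<longleftrightarrow> subst e A \<in> L"

definition unifiable :: "fm set \<Rightarrow> fm \<Rightarrow> bool" where
  "unifiable L A \<longleftrightarrow> (\<exists>e. unifier L A e)"

definition unitary_unification :: "fm set \<Rightarrow> bool" where
  "unitary_unification L \<longleftrightarrow>
     (\<forall>A. unifiable L A \<longrightarrow>
        (\<exists>e. unifier L A e \<and> (\<forall>m. unifier L A m \<longrightarrow> more_general L e m)))"


lemma fork_0: "fork 0 = chain 1"
  by (auto simp: fork_def chain_def)

lemma fork_1: "fork 1 = chain 2"
  by (auto simp: fork_def chain_def)

lemma is_frame_chain: "d \<ge> 1 \<Longrightarrow> is_frame (chain d)"
  by (auto simp: is_frame_def chain_def partial_order_on_def preorder_on_def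
      refl_on_def trans_def antisym_def intro!: bexI[of _ 0])

lemma is_frame_fork: "is_frame (fork n)"
  by (auto simp: is_frame_def fork_def partial_order_on_def preorder_on_def
      refl_on_def trans_def antisym_def)

lemma is_frame_join:
  assumes "is_frame F" "is_frame G"
  shows "is_frame (join F G)"
proof -
  from assms obtain r where "r \<in> worlds F" "\<forall>x\<in>worlds F. (r, x) \<in> acc F"
    by (auto simp: is_frame_def)
  then have "\<exists>r\<in>worlds (join F G). \<forall>x\<in>worlds (join F G). (r, x) \<in> acc (join F G)"
    by (intro bexI[of _ "Inl r"]) (auto simp: join_def image_iff Bex_def)
  moreover have "partial_order_on (worlds (join F G)) (acc (join F G))"
    using assms
    by (auto simp: is_frame_def join_def partial_order_on_def preorder_on_def refl_on_def
        image_iff Bex_def antisym_def intro!: transI dest: transD)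
  ultimately show ?thesis
    using assms by (auto simp: is_frame_def join_def)
qed

end

(*
  A logic with unitary unification need not make every formula projective, so a unifiable A is
  rewritten in a richer language, in which a single formula, coded, is projective and all
  unifiers of A factor through the unifiers of coded.  Every frame of H_un is a crown: a top T,
  an antichain M of points just below it, and a chain N below M.  Given a unifier mu, only two
  pieces of information about a model are needed besides the new valuation of A: which types
  (valuations of the variables of A) mu can produce at points of depth at most two over the
  given top, and where those points are.  The first is read off variables Qvar y at the top; the
  second is carried by variables 1 (depth one) and 4 (depth at most two).  Depth is counted
  after collapsing worlds with equal valuations, which is what formulas can see.

  coded says that A holds, that the markers are consistent, that all types at marked points are
  permitted, and that every set of permitted types can be extended by a root.  If coded fails at
  the top, the whole model is made constant; if it fails at a middle point, that point is merged
  with the top; if it fails below, the point receives the root type belonging to the set of types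
  of the middle points.  All three repairs are definable by substitutions and leave the points
  that force coded alone.
*)

theory Submission
  imports Defs "HOL-Library.Nat_Bijection"
begin

section \<open>Formulas, forcing and bisimulations\<close>

primrec vars :: "fm \<Rightarrow> nat set" where
  "vars (Var p) = {p}"
| "vars Bot = {}"
| "vars (And A B) = vars A \<union> vars B"
| "vars (Or A B) = vars A \<union> vars B"
| "vars (Imp A B) = vars A \<union> vars B"

lemma finite_vars [simp]: "finite (vars A)"
  by (induction A) auto

abbreviation Neg :: "fm \<Rightarrow> fm" where
  "Neg A \<equiv> Imp A Bot"

definition Conj :: "fm set \<Rightarrow> fm" where
  "Conj S = foldr And (SOME l. set l = S) (Neg Bot)"

definition Disj :: "fm set \<Rightarrow> fm" where
  "Disj S = foldr Or (SOME l. set l = S) Bot"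

lemma forces_Conj:
  assumes "finite S"
  shows "forces F V x (Conj S) \<longleftrightarrow> (\<forall>A\<in>S. forces F V x A)"
proof -
  have "set (SOME l. set l = S) = S"
    using finite_list[OF assms] by (rule someI_ex)
  moreover have "forces F V x (foldr And l (Neg Bot)) \<longleftrightarrow> (\<forall>A\<in>set l. forces F V x A)" for l
    by (induction l) auto
  ultimately show ?thesis by (simp add: Conj_def)
qed

lemma forces_Disj:
  assumes "finite S"
  shows "forces F V x (Disj S) \<longleftrightarrow> (\<exists>A\<in>S. forces F V x A)"
proof -
  have "set (SOME l. set l = S) = S"
    using finite_list[OF assms] by (rule someI_ex)
  moreover have "forces F V x (foldr Or l Bot) \<longleftrightarrow> (\<exists>A\<in>set l. forces F V x A)" for l
    by (induction l) auto
  ultimately show ?thesis by (simp add: Disj_def)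
qed

text \<open>The tool for collapsing models: \<open>Z\<close> has to respect only the variables in
  \<open>X\<close>, so points that differ elsewhere may be identified.\<close>

lemma forces_bisim:
  assumes "\<And>x y p. Z x y \<Longrightarrow> p \<in> X \<Longrightarrow> x \<in> V p \<longleftrightarrow> y \<in> U p"
    and "\<And>x y x'. Z x y \<Longrightarrow> (x, x') \<in> acc F \<Longrightarrow> \<exists>y'. (y, y') \<in> acc G \<and> Z x' y'"
    and "\<And>x y y'. Z x y \<Longrightarrow> (y, y') \<in> acc G \<Longrightarrow> \<exists>x'. (x, x') \<in> acc F \<and> Z x' y'"
    and "vars C \<subseteq> X" and "Z x y"
  shows "forces F V x C \<longleftrightarrow> forces G U y C"
  using assms(4,5)
proof (induction C arbitrary: x y)
  case (Imp C D)
  have "forces F V x' E \<longleftrightarrow> forces G U y' E" if "Z x' y'" "E \<in> {C, D}" for x' y' E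
    using Imp that by auto
  then show ?case
    using assms(2,3)[OF Imp.prems(2)] by (auto, blast, blast)
qed (use assms(1) in auto)

lemma forces_rename:
  "forces F V x (subst (\<lambda>p. Var (g p)) C) \<longleftrightarrow> forces F (\<lambda>p. V (g p)) x C"
  by (induction C arbitrary: x) auto

text \<open>Substitutions act on models: by \<open>forces_subst\<close>, forcing
  \<open>subst s C\<close> under \<open>V\<close> amounts to forcing \<open>C\<close> under this
  valuation. A repair of a model that is given by formulas is therefore a substitution.\<close>

definition eval_subst :: "'w frame \<Rightarrow> (nat \<Rightarrow> 'w set) \<Rightarrow> substitution \<Rightarrow> nat \<Rightarrow> 'w set" where
  "eval_subst F V s = (\<lambda>p. {x \<in> worlds F. forces F V x (s p)})"

lemma forces_Iff [simp]:
  "forces F V x (Iff C D) \<longleftrightarrow>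
     (\<forall>y. (x, y) \<in> acc F \<longrightarrow> forces F V y C \<longleftrightarrow> forces F V y D)"
  by (auto simp: Iff_def)

section \<open>Crowns\<close>

lemma finite_total_least:
  assumes "finite D" "D \<noteq> {}"
    and "\<And>x y. x \<in> D \<Longrightarrow> y \<in> D \<Longrightarrow> R x y \<or> R y x"
    and "\<And>x y z. R x y \<Longrightarrow> R y z \<Longrightarrow> R x z"
  shows "\<exists>m\<in>D. \<forall>y\<in>D. R m y"
  using assms(1-3)
proof (induction D rule: finite_ne_induct)
  case (insert x D)
  then obtain m where m: "m \<in> D" "\<forall>y\<in>D. R m y" by auto
  have "R x x" using insert.prems by blast
  moreover have "R x m \<or> R m x" using insert.prems m(1) by blast
  ultimately show ?case using m assms(4) by blast
qed auto

text \<open>For \<open>rhombus 0\<close>, and for chains ending in it, \<open>M\<close> is empty.\<close>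

locale crown =
  fixes G :: "'w frame" and T :: 'w and M N :: "'w set"
  assumes worlds_eq: "worlds G = insert T (M \<union> N)"
    and finite_worlds: "finite (worlds G)"
    and disjnt: "T \<notin> M" "T \<notin> N" "M \<inter> N = {}"
    and acc_worlds: "(x, y) \<in> acc G \<Longrightarrow> x \<in> worlds G \<and> y \<in> worlds G"
    and acc_refl: "x \<in> worlds G \<Longrightarrow> (x, x) \<in> acc G"
    and acc_trans: "(x, y) \<in> acc G \<Longrightarrow> (y, z) \<in> acc G \<Longrightarrow> (x, z) \<in> acc G"
    and acc_top: "x \<in> worlds G \<Longrightarrow> (x, T) \<in> acc G"
    and acc_from_top: "(T, y) \<in> acc G \<Longrightarrow> y = T"
    and acc_from_middle: "z \<in> M \<Longrightarrow> (z, y) \<in> acc G \<Longrightarrow> y = z \<or> y = T"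
    and acc_to_middle: "x \<in> N \<Longrightarrow> z \<in> M \<Longrightarrow> (x, z) \<in> acc G"
    and total_low: "x \<in> N \<Longrightarrow> y \<in> N \<Longrightarrow> (x, y) \<in> acc G \<or> (y, x) \<in> acc G"
begin

lemma T_world [simp]: "T \<in> worlds G"
  and M_world: "z \<in> M \<Longrightarrow> z \<in> worlds G"
  and N_world: "z \<in> N \<Longrightarrow> z \<in> worlds G"
  by (auto simp: worlds_eq)

lemma forces_mono:
  assumes "valuation_on G V" "forces G V x C" "(x, y) \<in> acc G"
  shows "forces G V y C"
  using assms(2,3)
proof (induction C arbitrary: x y)
  case (Var p)
  then show ?case using assms(1) by (auto simp: valuation_on_def)
next
  case (Imp C D)
  then show ?case by (auto intro: acc_trans)
qed auto

lemma valuation_eval_subst: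
  assumes "valuation_on G V"
  shows "valuation_on G (eval_subst G V s)"
  using forces_mono[OF assms] acc_worlds by (auto simp: valuation_on_def eval_subst_def)

lemma forces_subst:
  assumes "x \<in> worlds G"
  shows "forces G V x (subst s C) \<longleftrightarrow> forces G (eval_subst G V s) x C"
  using assms
proof (induction C arbitrary: x)
  case (Imp C D)
  then show ?case using acc_worlds by auto
qed (auto simp: eval_subst_def)

text \<open>\<open>T\<close> is above every world and sees only itself, so a negation speaks about
  \<open>T\<close> alone. Double negation lets a formula inspect the top from any world.\<close>

lemma forces_Neg:
  assumes "valuation_on G V" "x \<in> worlds G"
  shows "forces G V x (Neg C) \<longleftrightarrow> \<not> forces G V T C"
  using forces_mono[OF assms(1)] acc_top[OF assms(2)] acc_top acc_worlds by auto

lemma forces_agree: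
  assumes "\<And>z p. (x, z) \<in> acc G \<Longrightarrow> p \<in> vars C \<Longrightarrow> z \<in> V p \<longleftrightarrow> z \<in> U p"
    and "x \<in> worlds G"
  shows "forces G V x C \<longleftrightarrow> forces G U x C"
  by (rule forces_bisim[where Z = "\<lambda>a b. a = b \<and> (x, a) \<in> acc G" and X = "vars C"])
    (use assms acc_trans acc_refl in auto)

lemma low_least:
  assumes "D \<subseteq> N" "D \<noteq> {}"
  obtains m where "m \<in> D" "\<And>y. y \<in> D \<Longrightarrow> (m, y) \<in> acc G"
proof -
  have "finite D"
    using finite_worlds assms(1) by (auto simp: worlds_eq intro: finite_subset)
  then have "\<exists>m\<in>D. \<forall>y\<in>D. (m, y) \<in> acc G"
    by (rule finite_total_least[OF _ assms(2)]) (use assms(1) total_low acc_trans in blast)+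
  then show ?thesis using that by blast
qed

lemma low_greatest:
  assumes "D \<subseteq> N" "D \<noteq> {}"
  obtains m where "m \<in> D" "\<And>y. y \<in> D \<Longrightarrow> (y, m) \<in> acc G"
proof -
  have "finite D"
    using finite_worlds assms(1) by (auto simp: worlds_eq intro: finite_subset)
  then have "\<exists>m\<in>D. \<forall>y\<in>D. (y, m) \<in> acc G"
    by (rule finite_total_least[OF _ assms(2)]) (use assms(1) total_low acc_trans in blast)+
  then show ?thesis using that by blast
qed

end

lemma in_logic_crown:
  assumes "C \<in> logic \<F>" "G \<in> \<F>" "valuation_on G V" "x \<in> worlds G"
  shows "forces G V x C"
  using assms by (auto simp: logic_def)

section \<open>The frames of \<open>H_un\<close> are crowns\<close>

lemma crown_join_rhombus:
  assumes "m \<ge> 1"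
  shows "crown (join (chain d) (rhombus m)) (Inr (Inr 0)) ((Inr \<circ> Inl) ` {1..m})
           (Inl ` {..<d} \<union> {Inr (Inl 0)})"
  using assms
  by unfold_locales
    (auto simp: join_def chain_def fork_def rhombus_def image_iff Bex_def)

text \<open>Since \<open>rhombus 0\<close> is a single point, the join is a chain; that point serves
  as the top.\<close>

lemma crown_join_chain:
  "crown (join (chain d) (rhombus 0)) (Inr (Inl 0)) {} (Inl ` {..<d})"
  by unfold_locales
    (auto simp: join_def chain_def relabel_def rhombus_def image_iff Bex_def)

text \<open>The root of the fork counts as a low point; here it is the only one.\<close>

lemma crown_rhombus:
  assumes "m \<ge> 1"
  shows "crown (rhombus m) (Inr 0) (Inl ` {1..m}) {Inl 0}"
  using assms
  by unfold_locales
    (auto simp: join_def chain_def fork_def rhombus_def image_iff Bex_def)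

lemma crown_rhombus_0: "crown (rhombus 0) (Inl 0) {} {}"
  by unfold_locales (auto simp: chain_def relabel_def rhombus_def)

lemma crown_frame_iso:
  assumes F: "is_frame F" and iso: "frame_iso F G" and "crown G T M N"
  shows "\<exists>T M N. crown F T M N"
proof -
  interpret G: crown G T M N by fact
  obtain f where f: "bij_betw f (worlds F) (worlds G)"
    and acc_f: "\<And>x y. x \<in> worlds F \<Longrightarrow> y \<in> worlds F \<Longrightarrow> (x, y) \<in> acc F \<longleftrightarrow> (f x, f y) \<in> acc G"
    using iso by (auto simp: frame_iso_def)
  obtain t where t: "t \<in> worlds F" "f t = T"
    using f G.T_world by (metis bij_betw_def imageE)
  have inj: "x = y" if "x \<in> worlds F" "y \<in> worlds F" "f x = f y" for x y
    using f that by (auto simp: bij_betw_def inj_on_def)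
  have fw: "f x \<in> worlds G" if "x \<in> worlds F" for x
    using f that by (auto simp: bij_betw_def)
  have acc_F: "x \<in> worlds F \<and> y \<in> worlds F" if "(x, y) \<in> acc F" for x y
    using F that by (auto simp: is_frame_def partial_order_on_def preorder_on_def)
  have "crown F t {x \<in> worlds F. f x \<in> M} {x \<in> worlds F. f x \<in> N}"
  proof
    show "worlds F = insert t ({x \<in> worlds F. f x \<in> M} \<union> {x \<in> worlds F. f x \<in> N})"
      using fw t inj by (auto simp: G.worlds_eq)
    show "finite (worlds F)" using F by (simp add: is_frame_def)
  next
    fix x y assume "(x, y) \<in> acc F"
    then show "x \<in> worlds F \<and> y \<in> worlds F" by (rule acc_F)
  next
    fix x y z assume "(x, y) \<in> acc F" "(y, z) \<in> acc F"
    then show "(x, z) \<in> acc F" using acc_F acc_f G.acc_trans by blast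
  next
    fix y assume "(t, y) \<in> acc F"
    then have "y \<in> worlds F" "(f t, f y) \<in> acc G" using acc_F acc_f by blast+
    then show "y = t" using G.acc_from_top inj t by simp
  next
    fix z y assume "z \<in> {x \<in> worlds F. f x \<in> M}" "(z, y) \<in> acc F"
    then have "y \<in> worlds F" "z \<in> worlds F" "f z \<in> M" "(f z, f y) \<in> acc G"
      using acc_F acc_f by blast+
    then show "y = z \<or> y = t" using G.acc_from_middle[of "f z" "f y"] inj t by auto
  next
    fix x assume x: "x \<in> worlds F"
    then show "(x, x) \<in> acc F" using acc_f fw G.acc_refl by blast
    show "(x, t) \<in> acc F" using x acc_f[OF x t(1)] fw[OF x] G.acc_top t(2) by simp
  next
    fix x z assume "x \<in> {x \<in> worlds F. f x \<in> N}" "z \<in> {x \<in> worlds F. f x \<in> M}"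
    then show "(x, z) \<in> acc F" using acc_f G.acc_to_middle by blast
  next
    fix x y assume "x \<in> {x \<in> worlds F. f x \<in> N}" "y \<in> {x \<in> worlds F. f x \<in> N}"
    then show "(x, y) \<in> acc F \<or> (y, x) \<in> acc F" using acc_f G.total_low by blast
  next
    show "t \<notin> {x \<in> worlds F. f x \<in> M}" "t \<notin> {x \<in> worlds F. f x \<in> N}"
      "{x \<in> worlds F. f x \<in> M} \<inter> {x \<in> worlds F. f x \<in> N} = {}"
      using t G.disjnt by auto
  qed
  then show ?thesis by blast
qed

lemma H_un_crown:
  assumes "F \<in> H_un"
  shows "\<exists>T M N. crown F T M N"
proof -
  from assms obtain m where F: "is_frame F"
    and m: "frame_iso F (rhombus m) \<or> (\<exists>d\<ge>1. frame_iso F (join (chain d) (rhombus m)))"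
    by (auto simp: H_un_def)
  have "\<exists>T M N. crown (rhombus m) T M N"
    using crown_rhombus crown_rhombus_0 by (cases "m = 0") (simp, blast, metis One_nat_def Suc_leI gr0I)
  moreover have "\<exists>T M N. crown (join (chain d) (rhombus m)) T M N" for d
    using crown_join_rhombus crown_join_chain by (cases "m = 0") (simp, blast, metis One_nat_def Suc_leI gr0I)
  ultimately show ?thesis
    using m by (metis crown_frame_iso F)
qed

section \<open>The formula \<open>coded\<close>\<close>

text \<open>The variable \<open>p\<close> of \<open>A\<close> becomes \<open>3 * p\<close>; the variables \<open>1\<close> and \<open>4\<close> are the depth markers.\<close>

definition Qvar :: "nat set \<Rightarrow> nat" where
  "Qvar y = 3 * set_encode y + 2"

definition glue :: "'w \<Rightarrow> 'w set \<Rightarrow> 'w set \<Rightarrow> nat set \<Rightarrow> ('w \<Rightarrow> nat set) \<Rightarrow> nat set \<Rightarrow> nat \<Rightarrow> 'w set"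
  where "glue T M N t f r =
    (\<lambda>p. {x. x = T \<and> p \<in> t \<or> x \<in> M \<and> p \<in> f x \<or> x \<in> N \<and> p \<in> r})"

locale crown_class =
  fixes \<F> :: "'w frame set" and A :: fm
  assumes ex_crown: "G \<in> \<F> \<Longrightarrow> \<exists>T M N. crown G T M N"
begin

definition vtype :: "(nat \<Rightarrow> 'w set) \<Rightarrow> 'w \<Rightarrow> nat set" where
  "vtype V x = {p \<in> vars A. x \<in> V (3 * p)}"

definition permitted :: "(nat \<Rightarrow> 'w set) \<Rightarrow> 'w \<Rightarrow> nat set set" where
  "permitted V x = {y \<in> Pow (vars A). x \<in> V (Qvar y)}"

text \<open>Asks whether \<open>r\<close> can be the type of a root below top type \<open>t\<close>
  and middle types \<open>Y\<close>. \<open>Y\<close> matters only up to insertion of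
  \<open>t\<close>, since a middle point of the same type as the top adds nothing. If no crown of
  the class realizes these types above a low point, the forcing condition is vacuous.\<close>

definition extends :: "nat set \<Rightarrow> nat set set \<Rightarrow> nat set \<Rightarrow> bool" where
  "extends t Y r \<longleftrightarrow> r \<subseteq> t \<inter> \<Inter>Y \<and>
     (\<forall>G\<in>\<F>. \<forall>T M N f. crown G T M N \<longrightarrow> insert t (f ` M) = insert t Y \<longrightarrow>
        (\<forall>x\<in>N. forces G (glue T M N t f r) x A))"

text \<open>All subsets are tested because the middle points of a given model may realize only some
  of the permitted types.\<close>

definition good :: "nat set \<Rightarrow> nat set set \<Rightarrow> bool" where
  "good t S \<longleftrightarrow> (\<forall>Y\<subseteq>S. \<exists>r. extends t Y r)"

definition top_type :: "nat set \<Rightarrow> fm" where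
  "top_type t = And (Conj ((\<lambda>p. Neg (Neg (Var (3 * p)))) ` t))
                    (Conj ((\<lambda>p. Neg (Var (3 * p))) ` (vars A - t)))"

definition top_permitted :: "nat set set \<Rightarrow> fm" where
  "top_permitted S = And (Conj ((\<lambda>y. Neg (Neg (Var (Qvar y)))) ` S))
                    (Conj ((\<lambda>y. Neg (Var (Qvar y))) ` (Pow (vars A) - S)))"

text \<open>\<open>good\<close> refers to the class of frames and is no formula, but its arguments
  range over a finite set of pairs; excluding each bad pair at the top expresses it.\<close>

definition good_fm :: fm where
  "good_fm = Conj ((\<lambda>(t, S). Neg (And (top_type t) (top_permitted S))) `
     {(t, S). t \<subseteq> vars A \<and> S \<subseteq> Pow (vars A) \<and> \<not> good t S})"

text \<open>No formula says that a variable is not forced at the present world, so the variables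
  outside \<open>y\<close> stand as a disjunction in the succedent; the implication can then be
  violated only at a point whose type is exactly \<open>y\<close>.\<close>

definition permitted_fm :: fm where
  "permitted_fm = Conj ((\<lambda>y. Imp (And (Var 4) (Conj ((\<lambda>p. Var (3 * p)) ` y)))
       (Or (Neg (Neg (Var (Qvar y)))) (Disj ((\<lambda>p. Var (3 * p)) ` (vars A - y))))) ` Pow (vars A))"

text \<open>The conjunct \<open>(4 \<rightarrow> 1) \<rightarrow> 4\<close> makes every point without marker \<open>4\<close> see one that has \<open>4\<close> but not
  \<open>1\<close>; hence the middle points carry \<open>4\<close>, and their types must be permitted.\<close>

definition coded :: fm where
  "coded = And (subst (\<lambda>p. Var (3 * p)) A) (And (Neg (Neg (Var 1)))
     (And (Imp (Var 1) (And (Var 4) (Conj ((\<lambda>p. Or (Var (3 * p)) (Neg (Var (3 * p)))) ` vars A))))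
     (And (Imp (Imp (Var 4) (Var 1)) (Var 4)) (And permitted_fm good_fm))))"

lemma vtype_subset: "vtype V x \<subseteq> vars A"
  by (auto simp: vtype_def)

lemma finite_subset_vars: "t \<subseteq> vars A \<Longrightarrow> finite t"
  by (rule finite_subset) auto

lemma finite_type_pairs [simp]: "finite {(t, S). t \<subseteq> vars A \<and> S \<subseteq> Pow (vars A) \<and> R t S}"
  by (rule finite_subset[of _ "Pow (vars A) \<times> Pow (Pow (vars A))"]) auto

lemma finite_subset_Pow_vars: "S \<subseteq> Pow (vars A) \<Longrightarrow> finite S"
  by (rule finite_subset) auto

lemma forces_exact_type:
  assumes "y \<subseteq> vars A"
  shows "forces G V x (Conj ((\<lambda>p. Var (3 * p)) ` y)) \<and>
           \<not> forces G V x (Disj ((\<lambda>p. Var (3 * p)) ` (vars A - y))) \<longleftrightarrow> vtype V x = y"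
  using assms finite_subset_vars[OF assms] by (auto simp: forces_Conj forces_Disj vtype_def)

context
  fixes G :: "'w frame" and T M N and V
  assumes crown: "crown G T M N" and V: "valuation_on G V"
begin

interpretation crown G T M N by (rule crown)

lemma forces_top_type:
  assumes "t \<subseteq> vars A" "x \<in> worlds G"
  shows "forces G V x (top_type t) \<longleftrightarrow> vtype V T = t"
proof -
  have "finite t" using assms(1) by (rule finite_subset_vars)
  then show ?thesis
    unfolding top_type_def
    using assms by (simp add: forces_Conj forces_Neg[OF V] del: forces.simps(5)) (auto simp: vtype_def)
qed

lemma forces_top_permitted:
  assumes "S \<subseteq> Pow (vars A)" "x \<in> worlds G"
  shows "forces G V x (top_permitted S) \<longleftrightarrow> permitted V T = S"
proof -
  have "finite S" using assms(1) by (rule finite_subset_Pow_vars)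
  then show ?thesis
    unfolding top_permitted_def
    using assms by (simp add: forces_Conj forces_Neg[OF V] del: forces.simps(5)) (auto simp: permitted_def)
qed

lemma forces_good_fm:
  assumes "x \<in> worlds G"
  shows "forces G V x good_fm \<longleftrightarrow> good (vtype V T) (permitted V T)"
proof -
  have "forces G V x good_fm \<longleftrightarrow> (\<forall>t S. t \<subseteq> vars A \<and> S \<subseteq> Pow (vars A) \<and> \<not> good t S \<longrightarrow>
      \<not> (vtype V T = t \<and> permitted V T = S))"
    unfolding good_fm_def using assms
    by (simp add: forces_Conj forces_Neg[OF V] forces_top_type forces_top_permitted
        case_prod_beta del: forces.simps(5))
  moreover have "permitted V T \<subseteq> Pow (vars A)" by (auto simp: permitted_def)
  ultimately show ?thesis using vtype_subset[of V T] by blast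
qed

lemma forces_permitted_fm:
  assumes "x \<in> worlds G"
  shows "forces G V x permitted_fm \<longleftrightarrow>
    (\<forall>z. (x, z) \<in> acc G \<longrightarrow> z \<in> V 4 \<longrightarrow> vtype V z \<in> permitted V T)"
proof -
  have imp: "forces G V x (Imp (And C D) (Or (Neg (Neg (Var q))) E)) \<longleftrightarrow>
      (\<forall>z. (x, z) \<in> acc G \<longrightarrow> forces G V z C \<and> forces G V z D \<longrightarrow> T \<in> V q \<or> forces G V z E)"
    for C D E q
    unfolding forces.simps(5)[of G V x "And C D"] forces.simps(3,4)
    using forces_Neg[OF V] acc_worlds by (metis T_world forces.simps(1))
  have "forces G V x permitted_fm \<longleftrightarrow> (\<forall>y\<in>Pow (vars A). \<forall>z. (x, z) \<in> acc G \<longrightarrow>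
      z \<in> V 4 \<and> forces G V z (Conj ((\<lambda>p. Var (3 * p)) ` y)) \<longrightarrow>
      T \<in> V (Qvar y) \<or> forces G V z (Disj ((\<lambda>p. Var (3 * p)) ` (vars A - y))))"
    by (simp add: permitted_fm_def forces_Conj imp del: forces.simps(5))
  also have "\<dots> \<longleftrightarrow> (\<forall>y\<in>Pow (vars A). \<forall>z. (x, z) \<in> acc G \<longrightarrow> z \<in> V 4 \<longrightarrow>
      vtype V z = y \<longrightarrow> T \<in> V (Qvar y))"
    using forces_exact_type[of _ G V] by blast
  finally show ?thesis using vtype_subset[of V] by (auto simp: permitted_def)
qed

text \<open>The semantic form used from here on. Types grow towards \<open>T\<close>, so a world
  decides every variable of \<open>A\<close> exactly if it has the type of \<open>T\<close>; this
  yields the condition on marker \<open>1\<close>.\<close>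

lemma forces_coded:
  assumes "x \<in> worlds G"
  shows "forces G V x coded \<longleftrightarrow> forces G (\<lambda>p. V (3 * p)) x A \<and> T \<in> V 1 \<and>
    (\<forall>z. (x, z) \<in> acc G \<longrightarrow> z \<in> V 1 \<longrightarrow> vtype V z = vtype V T \<and> z \<in> V 4) \<and>
    (\<forall>z. (x, z) \<in> acc G \<longrightarrow> z \<notin> V 4 \<longrightarrow> (\<exists>w. (z, w) \<in> acc G \<and> w \<in> V 4 \<and> w \<notin> V 1)) \<and>
    (\<forall>z. (x, z) \<in> acc G \<longrightarrow> z \<in> V 4 \<longrightarrow> vtype V z \<in> permitted V T) \<and>
    good (vtype V T) (permitted V T)"
proof -
  have mono: "z \<in> V p \<Longrightarrow> (z, w) \<in> acc G \<Longrightarrow> w \<in> V p" for z w p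
    using V by (auto simp: valuation_on_def)
  have 1: "forces G V z (Conj ((\<lambda>p. Or (Var (3 * p)) (Neg (Var (3 * p)))) ` vars A))
      \<longleftrightarrow> vtype V z = vtype V T" if "z \<in> worlds G" for z
  proof -
    have "forces G V z (Conj ((\<lambda>p. Or (Var (3 * p)) (Neg (Var (3 * p)))) ` vars A))
      \<longleftrightarrow> (\<forall>p\<in>vars A. z \<in> V (3 * p) \<or> T \<notin> V (3 * p))"
      using that by (simp add: forces_Conj forces_Neg[OF V] del: forces.simps(5))
    then show ?thesis using mono acc_top[OF that] by (auto simp: vtype_def)
  qed
  show ?thesis
    unfolding coded_def forces.simps(3) forces_Neg[OF V assms] forces_Neg[OF V T_world]
      forces_rename forces_good_fm[OF assms] forces_permitted_fm[OF assms]
    using 1 acc_worlds by auto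
qed

end


text \<open>A low point sees the top and every middle point, so up to repetition the part above it
  consists of one root type, a set of types and a top type. Number and naming of the middle points
  are irrelevant, and \<open>extends\<close> can be verified on a single crown that has these types
  and a low point.\<close>

lemma glue_bisim:
  assumes "crown G T M N" "crown G' T' M' N'" "insert t (f ` M) = insert t (f' ` M')"
    and "x \<in> N" "x' \<in> N'"
    and V: "\<And>p. p \<in> vars A \<Longrightarrow> T \<in> V p \<longleftrightarrow> p \<in> t"
      "\<And>p z. p \<in> vars A \<Longrightarrow> z \<in> M \<Longrightarrow> z \<in> V p \<longleftrightarrow> p \<in> f z"
      "\<And>p z. p \<in> vars A \<Longrightarrow> z \<in> N \<Longrightarrow> (x, z) \<in> acc G \<Longrightarrow> z \<in> V p \<longleftrightarrow> p \<in> r"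
  shows "forces G V x A \<longleftrightarrow> forces G' (glue T' M' N' t f' r) x' A"
proof -
  interpret G: crown G T M N by fact
  interpret G': crown G' T' M' N' by fact
  define c where "c a = (if a = T then t else f a)" for a
  define c' where "c' a = (if a = T' then t else f' a)" for a
  have im: "c ` insert T M = c' ` insert T' M'"
  proof -
    have "c ` M = f ` M" "c' ` M' = f' ` M'"
      using G.disjnt(1) G'.disjnt(1) by (intro image_cong; force simp: c_def c'_def)+
    moreover have "c T = t" "c' T' = t" by (simp_all add: c_def c'_def)
    ultimately show ?thesis using assms(3) by (simp only: image_insert)
  qed
  define Z where "Z a b \<longleftrightarrow> (a \<in> N \<and> (x, a) \<in> acc G \<and> b \<in> N') \<or>
     (a \<in> insert T M \<and> b \<in> insert T' M' \<and> c a = c' b)" for a b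
  have Z_top: "Z T T'" by (simp add: Z_def c_def c'_def)
  show ?thesis
  proof (rule forces_bisim[where Z = Z and X = "vars A"])
    fix a b p assume "Z a b" "p \<in> vars A"
    then show "a \<in> V p \<longleftrightarrow> b \<in> glue T' M' N' t f' r p"
      using V G.disjnt G'.disjnt
      by (auto simp: Z_def glue_def c_def c'_def split: if_splits)
  next
    fix a b a' assume Z: "Z a b" and a': "(a, a') \<in> acc G"
    show "\<exists>b'. (b, b') \<in> acc G' \<and> Z a' b'"
    proof (cases "a \<in> N")
      case True
      then have b: "b \<in> N'" "(x, a) \<in> acc G" using Z G.disjnt by (auto simp: Z_def)
      show ?thesis
      proof (cases "a' \<in> N")
        case True
        then show ?thesis
          using b(1) G.acc_trans[OF b(2) a'] G'.acc_refl[OF G'.N_world[OF b(1)]]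
          unfolding Z_def by blast
      next
        case False
        then have "a' \<in> insert T M" using a' G.acc_worlds by (auto simp: G.worlds_eq)
        then obtain b' where "b' \<in> insert T' M'" "c a' = c' b'" using im by (metis imageE imageI)
        moreover from this have "(b, b') \<in> acc G'"
          using b G'.acc_to_middle G'.acc_top G'.N_world by auto
        ultimately show ?thesis using \<open>a' \<in> insert T M\<close> by (auto simp: Z_def)
      qed
    next
      case False
      then have "a \<in> insert T M" "b \<in> insert T' M'" using Z by (auto simp: Z_def)
      moreover from this have "a' = a \<or> a' = T"
        using a' G.acc_from_top G.acc_from_middle by auto
      moreover have "(b, b) \<in> acc G'" "(b, T') \<in> acc G'"
        using calculation(2) G'.acc_refl G'.acc_top G'.M_world by auto
      ultimately show ?thesis using Z Z_top by blast
    qed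
  next
    fix a b b' assume Z: "Z a b" and b': "(b, b') \<in> acc G'"
    show "\<exists>a'. (a, a') \<in> acc G \<and> Z a' b'"
    proof (cases "b \<in> N'")
      case True
      then have a: "a \<in> N" "(x, a) \<in> acc G" using Z G'.disjnt by (auto simp: Z_def)
      show ?thesis
      proof (cases "b' \<in> N'")
        case True
        then show ?thesis
          using a G.acc_refl[OF G.N_world[OF a(1)]] unfolding Z_def by blast
      next
        case False
        then have "b' \<in> insert T' M'" using b' G'.acc_worlds by (auto simp: G'.worlds_eq)
        then obtain a' where "a' \<in> insert T M" "c a' = c' b'" using im by (metis imageE imageI)
        moreover from this have "(a, a') \<in> acc G"
          using a G.acc_to_middle G.acc_top G.N_world by auto
        ultimately show ?thesis using \<open>b' \<in> insert T' M'\<close> by (auto simp: Z_def)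
      qed
    next
      case False
      then have "a \<in> insert T M" "b \<in> insert T' M'" using Z by (auto simp: Z_def)
      moreover from this have "b' = b \<or> b' = T'"
        using b' G'.acc_from_top G'.acc_from_middle by auto
      moreover have "(a, a) \<in> acc G" "(a, T) \<in> acc G"
        using calculation(1) G.acc_refl G.acc_top G.M_world by auto
      ultimately show ?thesis using Z Z_top by blast
    qed
  next
    show "Z x x'" using assms G.acc_refl G.N_world by (auto simp: Z_def)
  qed simp
qed

section \<open>Factoring a unifier through \<open>coded\<close>\<close>

context
  fixes \<mu> :: substitution
begin

definition target_vars :: "nat set" where
  "target_vars = (\<Union>p\<in>vars A. vars (\<mu> p))"

text \<open>Two kinds of type belong to \<mu>: this one records the variables that \<mu> uses,
  \<open>image_type\<close> the variables of \<open>A\<close> as evaluated after \<mu>.\<close>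

definition ktype :: "(nat \<Rightarrow> 'w set) \<Rightarrow> 'w \<Rightarrow> nat set" where
  "ktype V x = {p \<in> target_vars. x \<in> V p}"

definition image_type :: "'w frame \<Rightarrow> (nat \<Rightarrow> 'w set) \<Rightarrow> 'w \<Rightarrow> nat set" where
  "image_type G V x = {p \<in> vars A. forces G V x (\<mu> p)}"

text \<open>Depth at most two up to bisimulation, so \<open>z\<close> may well lie in the low chain.\<close>

definition shallow :: "'w frame \<Rightarrow> (nat \<Rightarrow> 'w set) \<Rightarrow> 'w \<Rightarrow> 'w \<Rightarrow> bool" where
  "shallow G V T z \<longleftrightarrow> (\<forall>w. (z, w) \<in> acc G \<longrightarrow> ktype V w = ktype V z \<or> ktype V w = ktype V T)"

text \<open>Collected over all models on all frames of the class, so that the set depends on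
  \<open>t\<close> alone and can be announced by variables at the top.\<close>

definition shallow_types :: "nat set \<Rightarrow> nat set set" where
  "shallow_types t = {image_type G V z | G T M N V z. G \<in> \<F> \<and> crown G T M N \<and>
     valuation_on G V \<and> z \<in> worlds G \<and> ktype V T = t \<and> shallow G V T z}"

definition top_fm :: fm where
  "top_fm = Conj ((\<lambda>p. Or (Var p) (Neg (Var p))) ` target_vars)"

text \<open>A variant of the axiom for depth two. The instance for \<open>p\<close> and
  \<open>q\<close> fails exactly if \<open>p\<close> is not yet forced and some world above has
  gained \<open>p\<close> but still lacks \<open>q\<close>, which holds at the top; the
  \<open>ktype\<close> of that world lies strictly in between.\<close>

definition shallow_fm :: fm where
  "shallow_fm =
     Conj ((\<lambda>(p, q). Or (Var p) (Or (Imp (Var p) (Var q)) (Neg (Var q)))) ` (target_vars \<times> target_vars))"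

definition ktype_fm :: "nat set \<Rightarrow> fm" where
  "ktype_fm t = And (Conj (Var ` t)) (Conj ((\<lambda>p. Neg (Var p)) ` (target_vars - t)))"

text \<open>The markers have remainder 1 modulo 3 and must be caught before the last branch, which
  is meant for the variables \<open>Qvar y\<close>. Evaluated at the top, its disjunction says that
  some shallow point over a top of this \<open>ktype\<close> has image type
  \<open>y\<close>.\<close>

definition factor :: substitution where
  "factor n = (if n = 1 then top_fm else if n = 4 then shallow_fm
     else if n mod 3 = 0 then \<mu> (n div 3)
     else Disj (ktype_fm ` {t. t \<subseteq> target_vars \<and> set_decode (n div 3) \<in> shallow_types t}))"

lemma finite_target_vars [simp]: "finite target_vars"
  by (simp add: target_vars_def)

lemma factor_Var: "factor (3 * p) = \<mu> p"
proof -
  have "3 * p \<noteq> 1" "3 * p \<noteq> 4" by presburger+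
  then show ?thesis by (simp add: factor_def)
qed

lemma factor_Qvar:
  assumes "y \<subseteq> vars A"
  shows "factor (Qvar y) = Disj (ktype_fm ` {t. t \<subseteq> target_vars \<and> y \<in> shallow_types t})"
proof -
  have "Qvar y \<noteq> 1" "Qvar y \<noteq> 4" "Qvar y mod 3 \<noteq> 0" "Qvar y div 3 = set_encode y"
    unfolding Qvar_def by presburger+
  moreover have "finite y" using assms by (rule finite_subset_vars)
  ultimately show ?thesis by (simp add: factor_def)
qed

lemma shallow_types_subset: "shallow_types t \<subseteq> Pow (vars A)"
  by (auto simp: shallow_types_def image_type_def)

lemma ktype_mono:
  "valuation_on G V \<Longrightarrow> (x, y) \<in> acc G \<Longrightarrow> ktype V x \<subseteq> ktype V y"
  by (auto simp: ktype_def valuation_on_def)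

text \<open>Above a shallow point only its own \<open>ktype\<close> and that of the top occur, so
  matching points of equal \<open>ktype\<close> is a bisimulation.\<close>

lemma shallow_image_type:
  assumes "crown G T M N" "crown G' T' M' N'" "valuation_on G V" "valuation_on G' V'"
    and z: "z \<in> worlds G" "shallow G V T z" and z': "z' \<in> worlds G'" "shallow G' V' T' z'"
    and k: "ktype V T = ktype V' T'" "ktype V z = ktype V' z'"
  shows "image_type G V z = image_type G' V' z'"
proof -
  interpret G: crown G T M N by fact
  interpret G': crown G' T' M' N' by fact
  define Z where "Z a b \<longleftrightarrow> (z, a) \<in> acc G \<and> (z', b) \<in> acc G' \<and> ktype V a = ktype V' b" for a b
  have "forces G V z (\<mu> p) \<longleftrightarrow> forces G' V' z' (\<mu> p)" if "p \<in> vars A" for p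
  proof (rule forces_bisim[where Z = Z and X = target_vars])
    fix a b p assume "Z a b" "p \<in> target_vars"
    then show "a \<in> V p \<longleftrightarrow> b \<in> V' p" by (auto simp: Z_def ktype_def)
  next
    fix a b a' assume Z: "Z a b" and a': "(a, a') \<in> acc G"
    from Z a' have za': "(z, a') \<in> acc G" by (auto simp: Z_def intro: G.acc_trans)
    show "\<exists>b'. (b, b') \<in> acc G' \<and> Z a' b'"
    proof (cases "ktype V a' = ktype V T")
      case True
      have "(b, T') \<in> acc G'" using Z G'.acc_top G'.acc_worlds by (auto simp: Z_def)
      then show ?thesis using Z True za' k G'.acc_trans by (auto simp: Z_def)
    next
      case False
      then have "ktype V a' = ktype V z" using z(2) za' by (auto simp: shallow_def)
      then have "ktype V a' = ktype V a"
        using ktype_mono[OF assms(3) a'] ktype_mono[OF assms(3), of z a] Z by (auto simp: Z_def)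
      then have "Z a' b" using Z za' by (auto simp: Z_def)
      moreover have "(b, b) \<in> acc G'" using Z G'.acc_refl G'.acc_worlds unfolding Z_def by blast
      ultimately show ?thesis by blast
    qed
  next
    fix a b b' assume Z: "Z a b" and b': "(b, b') \<in> acc G'"
    from Z b' have zb': "(z', b') \<in> acc G'" by (auto simp: Z_def intro: G'.acc_trans)
    show "\<exists>a'. (a, a') \<in> acc G \<and> Z a' b'"
    proof (cases "ktype V' b' = ktype V' T'")
      case True
      have "(a, T) \<in> acc G" using Z G.acc_top G.acc_worlds by (auto simp: Z_def)
      then show ?thesis using Z True zb' k G.acc_trans by (auto simp: Z_def)
    next
      case False
      then have "ktype V' b' = ktype V' z'" using z'(2) zb' by (auto simp: shallow_def)
      then have "ktype V' b' = ktype V' b"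
        using ktype_mono[OF assms(4) b'] ktype_mono[OF assms(4), of z' b] Z by (auto simp: Z_def)
      then have "Z a b'" using Z zb' by (auto simp: Z_def)
      moreover have "(a, a) \<in> acc G" using Z G.acc_refl G.acc_worlds unfolding Z_def by blast
      ultimately show ?thesis by blast
    qed
  next
    show "vars (\<mu> p) \<subseteq> target_vars" using that by (auto simp: target_vars_def)
    show "Z z z'" using k z(1) z'(1) G.acc_refl G'.acc_refl by (auto simp: Z_def)
  qed
  then show ?thesis by (auto simp: image_type_def)
qed

lemma shallow_top: "crown G T M N \<Longrightarrow> shallow G V T T"
  using crown.acc_from_top by (fastforce simp: shallow_def)

lemma shallow_middle: "crown G T M N \<Longrightarrow> z \<in> M \<Longrightarrow> shallow G V T z"
  using crown.acc_from_middle by (fastforce simp: shallow_def)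

text \<open>The types in \<open>Y\<close> may come from many models. Their witnesses can be rebuilt
  side by side as the middle points of one crown; as \<mu> unifies \<open>A\<close>, a low point of
  that crown exhibits a root type.\<close>

lemma good_shallow_types:
  assumes \<mu>: "unifier (logic \<F>) A \<mu>"
    and G: "G \<in> \<F>" and crown: "crown G T M N" and V: "valuation_on G V"
  shows "good (image_type G V T) (shallow_types (ktype V T))"
  unfolding good_def
proof (intro allI impI)
  fix Y assume Y: "Y \<subseteq> shallow_types (ktype V T)"
  define t where "t = image_type G V T"
  interpret G: crown G T M N by (rule crown)
  show "\<exists>r. extends t Y r"
  proof (cases "\<forall>G'\<in>\<F>. \<forall>T' M' N' f.
      crown G' T' M' N' \<longrightarrow> insert t (f ` M') = insert t Y \<longrightarrow> N' = {}")
    case True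
    \<comment> \<open>Without a low point to be tested, the empty root type works vacuously.\<close>
    have "extends t Y {}"
      unfolding extends_def
    proof (intro conjI ballI allI impI)
      fix G' T' M' N' f x
      assume *: "G' \<in> \<F>" "crown G' T' M' N'" "insert t (f ` M') = insert t Y" "x \<in> N'"
      then show "forces G' (glue T' M' N' t f {}) x A" using True[rule_format, OF *(1-3)] by simp
    qed simp
    then show ?thesis ..
  next
    case False
    then obtain G' T' M' N' f x where G': "G' \<in> \<F>" and crown': "crown G' T' M' N'"
      and f: "insert t (f ` M') = insert t Y" and x: "x \<in> N'"
      by auto
    interpret G': crown G' T' M' N' by (rule crown')
    \<comment> \<open>\<open>f z\<close> may be \<open>t\<close> instead of an element of
      \<open>Y\<close>, so \<open>t\<close> itself has to be attained; the top of \<open>G\<close>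
      attains it.\<close>
    have "t \<in> shallow_types (ktype V T)"
      unfolding shallow_types_def t_def using G crown V G.T_world shallow_top[OF crown] by blast
    then have "f z \<in> shallow_types (ktype V T)" if "z \<in> M'" for z
    proof -
      have "f z \<in> insert t Y" unfolding f[symmetric] using that by simp
      then show ?thesis using Y \<open>t \<in> shallow_types (ktype V T)\<close> by auto
    qed
    note fS = this
    define witness where "witness z k \<longleftrightarrow> (\<exists>Gz Tz Mz Nz Vz z'. crown Gz Tz Mz Nz \<and>
        valuation_on Gz Vz \<and> z' \<in> worlds Gz \<and> ktype Vz Tz = ktype V T \<and> shallow Gz Vz Tz z' \<and>
        f z = image_type Gz Vz z' \<and> k = ktype Vz z')" for z k
    have "\<exists>k. witness z k" if "z \<in> M'" for z
      using fS[OF that] unfolding shallow_types_def witness_def by blast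
    then obtain k where k: "\<And>z. z \<in> M' \<Longrightarrow> witness z (k z)"
      by metis
    have k_sub: "k z \<subseteq> ktype V T" if z: "z \<in> M'" for z
    proof -
      obtain Gz Tz Mz Nz Vz z' where "crown Gz Tz Mz Nz" "valuation_on Gz Vz" "z' \<in> worlds Gz"
        "ktype Vz Tz = ktype V T" "k z = ktype Vz z'"
        using k[OF z] unfolding witness_def by blast
      then show ?thesis using ktype_mono[of Gz Vz z' Tz] crown.acc_top[of Gz Tz Mz Nz z'] by simp
    qed
    \<comment> \<open>Middle points get the \<open>ktype\<close> of their witnesses, low points no
      variable at all; \<open>k_sub\<close> makes this upward closed.\<close>
    define V' where "V' p = {z. (z = T' \<and> p \<in> ktype V T) \<or> (z \<in> M' \<and> p \<in> k z)}" for p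
    have kT: "ktype V' T' = ktype V T"
      using G'.disjnt by (auto simp: V'_def ktype_def)
    have V': "valuation_on G' V'"
      using subsetD[OF k_sub] G'.acc_from_top G'.acc_from_middle G'.acc_worlds
      by (fastforce simp: valuation_on_def V'_def G'.worlds_eq)
    have fz: "image_type G' V' z = f z" if z: "z \<in> M'" for z
    proof -
      obtain Gz Tz Mz Nz Vz z' where w: "crown Gz Tz Mz Nz"
        "valuation_on Gz Vz" "z' \<in> worlds Gz" "ktype Vz Tz = ktype V T" "shallow Gz Vz Tz z'"
        "f z = image_type Gz Vz z'" "k z = ktype Vz z'"
        using k[OF z] unfolding witness_def by blast
      have "ktype V' z = k z"
        using G'.disjnt z w(7) by (auto simp: V'_def ktype_def)
      then show ?thesis
        using shallow_image_type[OF crown' w(1) V' w(2) G'.M_world[OF z] shallow_middle[OF crown' z]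
            w(3,5)] kT w by simp
    qed
    have ft: "image_type G' V' T' = t"
      unfolding t_def
      by (rule shallow_image_type[OF crown' crown V' V G'.T_world shallow_top[OF crown'] G.T_world
            shallow_top[OF crown]]) (use kT in auto)
    \<comment> \<open>All low points have the same empty valuation and see the same middle points
      and top, so \<open>r\<close> does not depend on the choice of \<open>x\<close>.\<close>
    define r where "r = image_type G' V' x"
    have low: "image_type G' V' z = r" if z: "z \<in> N'" for z
    proof -
      define Z where "Z a b \<longleftrightarrow> a = b \<or> a \<in> N' \<and> b \<in> N'" for a b
      have "forces G' V' z C \<longleftrightarrow> forces G' V' x C" for C
      proof (rule forces_bisim[where Z = Z and X = UNIV])
        fix a b p assume "Z a b"
        then show "a \<in> V' p \<longleftrightarrow> b \<in> V' p" using G'.disjnt by (auto simp: Z_def V'_def)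
      next
        have step: "\<exists>b'. (b, b') \<in> acc G' \<and> Z a' b'" if "Z a b" "(a, a') \<in> acc G'" for a b a'
        proof (cases "a' \<in> N'")
          case True
          moreover have "a \<in> insert T' (M' \<union> N')"
            using that(2) G'.acc_worlds unfolding G'.worlds_eq by blast
          ultimately have "a \<in> N'"
            using that(2) G'.acc_from_top G'.acc_from_middle G'.disjnt by blast
          then have "b \<in> N'" using that(1) by (auto simp: Z_def)
          then show ?thesis using True G'.acc_refl G'.N_world by (auto simp: Z_def)
        next
          case False
          then have "a' \<in> insert T' M'" using that(2) G'.acc_worlds by (auto simp: G'.worlds_eq)
          then have "(b, a') \<in> acc G'"
            using that G'.acc_to_middle G'.acc_top G'.N_world by (auto simp: Z_def)
          then show ?thesis by (auto simp: Z_def)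
        qed
        fix a b
        assume Z: "Z a b"
        show "\<exists>b'. (b, b') \<in> acc G' \<and> Z a' b'" if "(a, a') \<in> acc G'" for a'
          using step Z that by blast
        show "\<exists>a'. (a, a') \<in> acc G' \<and> Z a' b'" if "(b, b') \<in> acc G'" for b'
          using step[of b a b'] Z that unfolding Z_def by blast
      qed (use x z in \<open>auto simp: Z_def\<close>)
      then show ?thesis by (auto simp: image_type_def r_def)
    qed
    have A: "forces G' (eval_subst G' V' \<mu>) x A"
      using \<mu> in_logic_crown[OF _ G' V'] G'.N_world[OF x] G'.forces_subst[symmetric]
      by (simp add: unifier_def)
    have r: "r \<subseteq> image_type G' V' w" if "(x, w) \<in> acc G'" for w
      using that G'.forces_mono[OF V'] by (auto simp: r_def image_type_def)
    have "r \<subseteq> t" using r[of T'] ft G'.acc_top[OF G'.N_world[OF x]] by simp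
    moreover have "r \<subseteq> f z" if "z \<in> M'" for z
      using r[of z] fz[OF that] G'.acc_to_middle[OF x that] by simp
    moreover have "y = t \<or> y \<in> f ` M'" if "y \<in> Y" for y
    proof -
      have "y \<in> insert t (f ` M')" unfolding f using that by simp
      then show ?thesis by simp
    qed
    ultimately have rY: "r \<subseteq> t \<inter> \<Inter>Y" by blast
    have glue: "forces H (glue TH MH NH t g r) y A"
      if H: "crown H TH MH NH" "insert t (g ` MH) = insert t Y" "y \<in> NH" for H TH MH NH g y
    proof -
      have eval: "z \<in> eval_subst G' V' \<mu> p \<longleftrightarrow> p \<in> image_type G' V' z"
        if "z \<in> worlds G'" "p \<in> vars A" for z p
        using that by (simp add: eval_subst_def image_type_def)
      have "forces G' (eval_subst G' V' \<mu>) x A \<longleftrightarrow> forces H (glue TH MH NH t g r) y A"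
      proof (rule glue_bisim[OF crown' H(1) _ x H(3)])
        show "insert t (f ` M') = insert t (g ` MH)" unfolding f H(2) ..
      qed (simp_all add: eval ft fz low G'.M_world G'.N_world)
      then show ?thesis using A by simp
    qed
    have "extends t Y r"
      unfolding extends_def using rY glue by (intro conjI ballI allI impI)
    then show ?thesis by blast
  qed
qed

text \<open>Under \<open>factor\<close>, marker \<open>1\<close> holds at the points with the
  \<open>ktype\<close> of the top, marker \<open>4\<close> at the shallow points, and the permitted
  types become \<open>shallow_types\<close>. Each conjunct of \<open>coded\<close> is then a fact
  about \<mu>, the last one being \<open>good_shallow_types\<close>.\<close>

lemma forces_factor_coded:
  assumes \<mu>: "unifier (logic \<F>) A \<mu>"
    and G: "G \<in> \<F>" and crown: "crown G T M N" and V: "valuation_on G V" and x: "x \<in> worlds G"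
  shows "forces G (eval_subst G V factor) x coded"
proof -
  interpret crown G T M N by (rule crown)
  define V' where "V' = eval_subst G V factor"
  have V': "valuation_on G V'" unfolding V'_def by (rule valuation_eval_subst[OF V])
  have vtype: "vtype V' z = image_type G V z" if "z \<in> worlds G" for z
    using that by (auto simp: vtype_def V'_def eval_subst_def image_type_def factor_Var)
  have top: "z \<in> V' 1 \<longleftrightarrow> ktype V z = ktype V T" if "z \<in> worlds G" for z
  proof -
    have "z \<in> V' 1 \<longleftrightarrow> (\<forall>p\<in>target_vars. z \<in> V p \<or> T \<notin> V p)"
      using that by (simp add: V'_def eval_subst_def factor_def top_fm_def forces_Conj
          forces_Neg[OF V] del: forces.simps(5))
    then show ?thesis
      using ktype_mono[OF V acc_top[OF that]] by (auto simp: ktype_def)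
  qed
  have sh: "z \<in> V' 4 \<longleftrightarrow> shallow G V T z" if z: "z \<in> worlds G" for z
  proof -
    have iff: "z \<in> V' 4 \<longleftrightarrow> (\<forall>p\<in>target_vars. \<forall>q\<in>target_vars. z \<in> V p \<or>
        (\<forall>w. (z, w) \<in> acc G \<longrightarrow> w \<in> V p \<longrightarrow> w \<in> V q) \<or> T \<notin> V q)"
      using that by (simp add: V'_def eval_subst_def factor_def shallow_fm_def forces_Conj
          forces_Neg[OF V] case_prod_beta del: forces.simps(5)) simp
    show ?thesis
    proof
      assume L: "z \<in> V' 4"
      show "shallow G V T z"
        unfolding shallow_def
      proof (intro allI impI, rule ccontr)
        fix w assume w: "(z, w) \<in> acc G" "\<not> (ktype V w = ktype V z \<or> ktype V w = ktype V T)"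
        have "ktype V z \<subseteq> ktype V w" "ktype V w \<subseteq> ktype V T"
          using ktype_mono[OF V] w(1) acc_top acc_worlds by blast+
        then obtain p q where "p \<in> ktype V w - ktype V z" "q \<in> ktype V T - ktype V w"
          using w(2) by blast
        then show False using iff L w(1) by (auto simp: ktype_def)
      qed
    next
      assume R: "shallow G V T z"
      show "z \<in> V' 4"
        unfolding iff
      proof (intro ballI, rule ccontr)
        fix p q assume pq: "p \<in> target_vars" "q \<in> target_vars"
          and n: "\<not> (z \<in> V p \<or> (\<forall>w. (z, w) \<in> acc G \<longrightarrow> w \<in> V p \<longrightarrow> w \<in> V q) \<or> T \<notin> V q)"
        then obtain w where w: "(z, w) \<in> acc G" "w \<in> V p" "w \<notin> V q" by auto
        have "ktype V w = ktype V z \<or> ktype V w = ktype V T"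
          using R w(1) by (auto simp: shallow_def)
        then show False using n pq w by (auto simp: ktype_def)
      qed
    qed
  qed
  have Q: "T \<in> V' (Qvar y) \<longleftrightarrow> y \<in> shallow_types (ktype V T)" if y: "y \<subseteq> vars A" for y
  proof -
    have "forces G V T (ktype_fm t) \<longleftrightarrow> t = ktype V T" if "t \<subseteq> target_vars" for t
    proof -
      have "finite t" using that by (rule finite_subset) simp
      then have "forces G V T (ktype_fm t) \<longleftrightarrow> (\<forall>p\<in>t. T \<in> V p) \<and> (\<forall>p\<in>target_vars - t. T \<notin> V p)"
        by (simp add: ktype_fm_def forces_Conj forces_Neg[OF V] del: forces.simps(5))
      then show ?thesis using that by (auto simp: ktype_def)
    qed
    moreover have "finite {t. t \<subseteq> target_vars \<and> y \<in> shallow_types t}"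
      by (rule finite_subset[of _ "Pow target_vars"]) auto
    ultimately have "T \<in> V' (Qvar y) \<longleftrightarrow> ktype V T \<subseteq> target_vars \<and> y \<in> shallow_types (ktype V T)"
      by (auto simp: V'_def eval_subst_def factor_Qvar[OF y] forces_Disj)
    then show ?thesis by (auto simp: ktype_def)
  qed
  have permitted: "permitted V' T = shallow_types (ktype V T)"
    using Q shallow_types_subset by (auto simp: permitted_def)
  have forces_A: "forces G (\<lambda>p. V' (3 * p)) x A"
  proof -
    have "forces G (eval_subst G V \<mu>) x A"
      using \<mu> in_logic_crown[OF _ G V x] forces_subst[OF x, symmetric] by (simp add: unifier_def)
    moreover have "(\<lambda>p. V' (3 * p)) = eval_subst G V \<mu>"
      by (simp add: V'_def eval_subst_def factor_Var)
    ultimately show ?thesis by simp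
  qed
  have T1: "T \<in> V' 1" using top[OF T_world] by simp
  have upper: "vtype V' z = vtype V' T \<and> z \<in> V' 4" if "z \<in> worlds G" "z \<in> V' 1" for z
  proof -
    have k: "ktype V z = ktype V T" using top that by simp
    have "shallow G V T z"
      unfolding shallow_def using k ktype_mono[OF V] acc_top acc_worlds by (metis subset_antisym)
    moreover from this have "image_type G V z = image_type G V T"
      using shallow_image_type[OF crown crown V V that(1) _ T_world shallow_top[OF crown]] k by simp
    ultimately show ?thesis using sh vtype that by simp
  qed
  have deep: "\<exists>w. (z, w) \<in> acc G \<and> w \<in> V' 4 \<and> w \<notin> V' 1"
    if z: "z \<in> worlds G" "z \<notin> V' 4" for z
  proof -
    have zN: "z \<in> N"
      using z sh shallow_top[OF crown] shallow_middle[OF crown] by (auto simp: worlds_eq)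
    show ?thesis
    proof (cases "\<exists>w\<in>M. w \<notin> V' 1")
      case True
      then show ?thesis
        using zN acc_to_middle sh shallow_middle[OF crown] M_world by metis
    next
      case False
      \<comment> \<open>All middle points have the \<open>ktype\<close> of the top here. The highest
        low point above \<open>z\<close> that differs from the top is then shallow.\<close>
      define D where "D = {w \<in> N. (z, w) \<in> acc G \<and> w \<notin> V' 1}"
      have "z \<notin> V' 1"
        using upper z by blast
      then have "D \<noteq> {}" "D \<subseteq> N" using zN acc_refl z by (auto simp: D_def)
      then obtain m where m: "m \<in> D" "\<And>y. y \<in> D \<Longrightarrow> (y, m) \<in> acc G"
        using low_greatest by metis
      have "ktype V w = ktype V m \<or> ktype V w = ktype V T" if w: "(m, w) \<in> acc G" for w
      proof (cases "w \<in> V' 1")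
        case True
        then show ?thesis using top w acc_worlds by blast
      next
        case wu: False
        have "w \<in> N"
          using wu w False T1 acc_worlds[OF w] by (auto simp: worlds_eq)
        then have "w \<in> D" using wu m(1) w acc_trans by (auto simp: D_def)
        then show ?thesis using m(2) ktype_mono[OF V] w by blast
      qed
      then have "shallow G V T m" by (auto simp: shallow_def)
      then show ?thesis using m(1) sh N_world by (auto simp: D_def)
    qed
  qed
  have types: "vtype V' z \<in> permitted V' T" if "z \<in> worlds G" "z \<in> V' 4" for z
  proof -
    have "shallow G V T z" using sh that by simp
    then show ?thesis
      unfolding permitted vtype[OF that(1)] shallow_types_def using that(1) G crown V by blast
  qed
  have "good (vtype V' T) (permitted V' T)"
    using good_shallow_types[OF \<mu> G crown V] by (simp add: permitted vtype)
  then show ?thesis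
    unfolding V'_def[symmetric] forces_coded[OF crown V' x]
  proof (intro conjI allI impI)
    fix z assume "(x, z) \<in> acc G"
    then have z: "z \<in> worlds G" using acc_worlds by blast
    show "vtype V' z = vtype V' T" "z \<in> V' 4" if "z \<in> V' 1"
      using upper[OF z that] by simp_all
    show "\<exists>w. (z, w) \<in> acc G \<and> w \<in> V' 4 \<and> w \<notin> V' 1" if "z \<notin> V' 4"
      by (rule deep[OF z that])
    show "vtype V' z \<in> permitted V' T" if "z \<in> V' 4"
      by (rule types[OF z that])
  qed (rule forces_A T1)+
qed

end


section \<open>Repairing models\<close>

definition repair_top :: "nat set \<Rightarrow> substitution" where
  "repair_top a n = And (Imp coded (Var n)) (if n \<in> a then Neg Bot else Neg (Neg coded))"

text \<open>Meant for low points failing \<open>coded\<close> after the upper repairs: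
  \<open>coded\<close> in the antecedent keeps low points from counting, marker \<open>1\<close> in
  the succedent exempts the top, so only middle points of type exactly \<open>y\<close> can refute
  it.\<close>

definition no_middle :: "nat set \<Rightarrow> fm" where
  "no_middle y = Imp (And coded (And (Var 4) (Conj ((\<lambda>p. Var (3 * p)) ` y))))
     (Or (Var 1) (Disj ((\<lambda>p. Var (3 * p)) ` (vars A - y))))"

text \<open>Only meaningful if some \<open>r\<close> satisfies \<open>extends t Y r\<close>, which \<open>good\<close> guarantees.\<close>

definition root :: "nat set \<Rightarrow> nat set set \<Rightarrow> nat set" where
  "root t Y = (SOME r. extends t Y r)"

text \<open>At a low point \<open>x\<close> not forcing \<open>coded\<close>, the conjunct of \<open>(t, Y)\<close> fails exactly when \<open>t\<close> is
  the top type and \<open>Y\<close> the set of types of the middle points without marker \<open>1\<close>.\<close>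

definition in_root :: "nat \<Rightarrow> fm" where
  "in_root p = Conj ((\<lambda>(t, Y). Imp (And (top_type t) (Conj (no_middle ` (Pow (vars A) - Y))))
       (Or coded (Disj (no_middle ` Y)))) `
     {(t, Y). t \<subseteq> vars A \<and> Y \<subseteq> Pow (vars A) \<and> p \<notin> root t Y})"

text \<open>Failing points lose both markers, which frees their types from the conditions tied to
  markers. Where \<open>coded\<close> holds, \<open>in_root\<close> is true and
  \<open>Imp coded (Var n)\<close> returns the old value. The variables \<open>Qvar y\<close> stay,
  as only their value at the top counts.\<close>

definition repair_low :: substitution where
  "repair_low n = (if n = 1 \<or> n = 4 then And coded (Var n)
     else if n mod 3 = 0 \<and> n div 3 \<in> vars A then And (Imp coded (Var n)) (in_root (n div 3))
     else Var n)"

context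
  fixes G :: "'w frame" and T M N and V
  assumes G: "G \<in> \<F>" and crown: "crown G T M N" and V: "valuation_on G V"
begin

interpretation crown G T M N by (rule crown)

text \<open>One substitution performs both upper repairs. By the third conclusion and monotonicity,
  \<open>coded\<close> then holds at all low points or at none. The last three conclusions are the
  hypotheses of \<open>repair_low\<close>.\<close>

lemma repair_top:
  fixes a
  defines "U \<equiv> eval_subst G V (repair_top a)"
  assumes a: "\<forall>U. (\<forall>z\<in>worlds G. \<forall>n. z \<in> U n \<longleftrightarrow> n \<in> a) \<longrightarrow> (\<forall>x\<in>worlds G. forces G U x coded)"
  shows "x \<in> worlds G \<Longrightarrow> forces G V x coded \<Longrightarrow> x \<in> U n \<longleftrightarrow> x \<in> V n"
    and "z \<in> insert T M \<Longrightarrow> forces G U z coded"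
    and "x \<in> N \<Longrightarrow> \<not> forces G U x coded \<Longrightarrow> (x, y) \<in> acc G \<Longrightarrow> y \<in> N \<Longrightarrow> \<not> forces G U y coded"
    and "x \<in> N \<Longrightarrow> \<not> forces G U x coded \<Longrightarrow> \<exists>z\<in>M. z \<notin> U 1"
proof -
  have U: "valuation_on G U" unfolding U_def by (rule valuation_eval_subst[OF V])
  have mono: "z \<in> W p \<Longrightarrow> (z, w) \<in> acc G \<Longrightarrow> w \<in> W p" if "valuation_on G W" for z w p W
    using that by (auto simp: valuation_on_def)
  have B_mono: "forces G W z coded \<Longrightarrow> (z, w) \<in> acc G \<Longrightarrow> forces G W w coded" if "valuation_on G W" for z w W
    by (rule forces_mono[OF that])
  \<comment> \<open>If \<open>coded\<close> fails at \<open>T\<close>, it fails everywhere, the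
    implication is trivially true and only membership in \<open>a\<close> remains; otherwise the
    second conjunct is trivially true.\<close>
  have U_iff: "x \<in> U n \<longleftrightarrow> (\<forall>z. (x, z) \<in> acc G \<longrightarrow> forces G V z coded \<longrightarrow> z \<in> V n) \<and>
      (n \<in> a \<or> forces G V T coded)" if "x \<in> worlds G" for x n
  proof -
    have "forces G V x (Imp coded (Var n)) \<longleftrightarrow>
        (\<forall>z. (x, z) \<in> acc G \<longrightarrow> forces G V z coded \<longrightarrow> z \<in> V n)" by simp
    moreover have "forces G V x (Neg (Neg coded)) \<longleftrightarrow> forces G V T coded"
      using that by (simp add: forces_Neg[OF V] del: forces.simps(5))
    moreover have "forces G V x (Neg Bot)" by simp
    ultimately show ?thesis
      using that by (simp add: U_def eval_subst_def repair_top_def del: forces.simps(5))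
  qed
  show agree: "x \<in> U n \<longleftrightarrow> x \<in> V n" if "x \<in> worlds G" "forces G V x coded" for x n
  proof -
    have "forces G V T coded" by (rule B_mono[OF V that(2) acc_top[OF that(1)]])
    then show ?thesis using U_iff[OF that(1)] mono[OF V] acc_refl[OF that(1)] that(2) by blast
  qed
  have U_const: "forces G U x coded" if nT: "\<not> forces G V T coded" and x: "x \<in> worlds G" for x
  proof (rule a[rule_format, OF _ x])
    fix z n assume z: "z \<in> worlds G"
    have "\<not> forces G V w coded" if "(z, w) \<in> acc G" for w
      using nT B_mono[OF V] acc_top acc_worlds[OF that] by blast
    then show "z \<in> U n \<longleftrightarrow> n \<in> a" using U_iff[OF z] nT by blast
  qed
  show topM: "forces G U z coded" if z: "z \<in> insert T M" for z
  proof (cases "forces G V T coded")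
    case False
    then show ?thesis using U_const[OF False] z M_world by auto
  next
    case True
    have zw: "z \<in> worlds G" using z M_world by auto
    show ?thesis
    proof (cases "forces G V z coded")
      case zB: True
      have "forces G U z coded \<longleftrightarrow> forces G V z coded"
        by (rule forces_agree[OF _ zw]) (use agree acc_worlds B_mono[OF V zB] in blast)
      then show ?thesis using zB by simp
    next
      \<comment> \<open>\<open>z\<close> sees only itself and \<open>T\<close>, so it takes over the
        valuation of \<open>T\<close> and becomes bisimilar to it.\<close>
      case zB: False
      have up: "w = z \<or> w = T" if "(z, w) \<in> acc G" for w
        using z that acc_from_middle acc_from_top by blast
      have zT: "z \<in> U n \<longleftrightarrow> T \<in> V n" for n
        using U_iff[OF zw] True zB up acc_top[OF zw] by blast
      have "forces G U z coded \<longleftrightarrow> forces G V T coded"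
      proof (rule forces_bisim[where Z = "\<lambda>p q. (p = z \<or> p = T) \<and> q = T" and X = UNIV])
        show "p \<in> U n \<longleftrightarrow> q \<in> V n" if "(p = z \<or> p = T) \<and> q = T" for p q n
          using that zT agree[OF T_world True] by blast
        show "\<exists>q'. (q, q') \<in> acc G \<and> (p' = z \<or> p' = T) \<and> q' = T"
          if "(p = z \<or> p = T) \<and> q = T" "(p, p') \<in> acc G" for p q p'
          using that up acc_from_top acc_refl[OF T_world] by blast
        show "\<exists>p'. (p, p') \<in> acc G \<and> (p' = z \<or> p' = T) \<and> q' = T"
          if "(p = z \<or> p = T) \<and> q = T" "(q, q') \<in> acc G" for p q q'
          using that acc_from_top acc_top zw by blast
      qed simp_all
      then show ?thesis using True by simp
    qed
  qed
  have low: "\<not> forces G V y coded"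
    if x: "x \<in> N" "\<not> forces G U x coded" and y: "(x, y) \<in> acc G" "y \<in> N" for x y
  proof
    assume yB: "forces G V y coded"
    \<comment> \<open>Let \<open>m\<close> be the lowest such point. The points between
      \<open>x\<close> and \<open>m\<close> receive the valuation of \<open>m\<close>, so
      \<open>x\<close> would be bisimilar to \<open>m\<close> and force
      \<open>coded\<close>.\<close>
    define D where "D = {y \<in> N. (x, y) \<in> acc G \<and> forces G V y coded}"
    have "D \<subseteq> N" "D \<noteq> {}" using y yB by (auto simp: D_def)
    then obtain m where m: "m \<in> D" "\<And>y. y \<in> D \<Longrightarrow> (m, y) \<in> acc G"
      using low_least by metis
    then have mN: "m \<in> N" and xm: "(x, m) \<in> acc G" and mB: "forces G V m coded"
      by (auto simp: D_def)
    have TB: "forces G V T coded" using mB B_mono[OF V] acc_top N_world[OF mN] by blast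
    have above: "(m, z) \<in> acc G" if "(x, z) \<in> acc G" "forces G V z coded" for z
    proof (cases "z \<in> N")
      case True
      then show ?thesis using m(2) that by (simp add: D_def)
    next
      case False
      then show ?thesis
        using acc_worlds[OF that(1)] acc_to_middle mN acc_top N_world by (auto simp: worlds_eq)
    qed
    define Z where "Z p q \<longleftrightarrow> p = q \<and> (m, p) \<in> acc G \<or>
      q = m \<and> p \<in> N \<and> (x, p) \<in> acc G \<and> (p, m) \<in> acc G" for p q
    have "forces G U x coded \<longleftrightarrow> forces G V m coded"
    proof (rule forces_bisim[where Z = Z and X = UNIV])
      fix p q n assume "Z p q"
      then consider "p = q" "(m, p) \<in> acc G" | "q = m" "p \<in> N" "(x, p) \<in> acc G" "(p, m) \<in> acc G"
        unfolding Z_def by blast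
      then show "p \<in> U n \<longleftrightarrow> q \<in> V n"
      proof cases
        case 1
        then show ?thesis using agree acc_worlds B_mono[OF V mB] by blast
      next
        case 2
        have "p \<in> U n \<longleftrightarrow> (\<forall>z. (p, z) \<in> acc G \<longrightarrow> forces G V z coded \<longrightarrow> z \<in> V n)"
          using U_iff[OF N_world[OF 2(2)]] TB by blast
        also have "\<dots> \<longleftrightarrow> m \<in> V n"
          using 2(3,4) mB above acc_trans mono[OF V] by blast
        finally show ?thesis using 2(1) by simp
      qed
    next
      fix p q p' assume Z: "Z p q" and p': "(p, p') \<in> acc G"
      show "\<exists>q'. (q, q') \<in> acc G \<and> Z p' q'"
      proof (cases "(m, p') \<in> acc G")
        case True
        moreover have "(q, p') \<in> acc G" using Z p' True unfolding Z_def by blast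
        ultimately show ?thesis unfolding Z_def by blast
      next
        case False
        have p: "q = m" "p \<in> N" "(x, p) \<in> acc G" "(p, m) \<in> acc G"
          using Z p' False acc_trans unfolding Z_def by blast+
        have "p' \<in> N"
          using False acc_worlds[OF p'] acc_to_middle[OF mN] acc_top[OF N_world[OF mN]]
          by (auto simp: worlds_eq)
        moreover from this have "(p', m) \<in> acc G" using total_low[OF mN] False by blast
        moreover have "(x, p') \<in> acc G" using p(3) p' acc_trans by blast
        moreover have "(m, m) \<in> acc G" using mN N_world acc_refl by blast
        ultimately show ?thesis using p(1) unfolding Z_def by blast
      qed
    next
      fix p q q' assume Z: "Z p q" and q': "(q, q') \<in> acc G"
      then have "(p, q') \<in> acc G" "(m, q') \<in> acc G" unfolding Z_def using acc_trans by blast+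
      then show "\<exists>p'. (p, p') \<in> acc G \<and> Z p' q'" unfolding Z_def by blast
    next
      show "Z x m" using x(1) xm N_world acc_refl unfolding Z_def by blast
    qed simp
    then show False using x(2) mB by simp
  qed
  \<comment> \<open>By \<open>low\<close>, no low point above such an \<open>x\<close> forced
    \<open>coded\<close> before the repair, so all of them get one common valuation, determined by
    top and middle.\<close>
  have above_iff: "y \<in> U n \<longleftrightarrow> (\<forall>z\<in>insert T M. forces G V z coded \<longrightarrow> z \<in> V n)"
    if x: "x \<in> N" "\<not> forces G U x coded" and y: "(x, y) \<in> acc G" "y \<in> N" for x y n
  proof -
    have "forces G V T coded" using U_const x N_world by blast
    then have "y \<in> U n \<longleftrightarrow> (\<forall>z. (y, z) \<in> acc G \<longrightarrow> forces G V z coded \<longrightarrow> z \<in> V n)"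
      using U_iff[OF N_world[OF y(2)]] by blast
    also have "\<dots> \<longleftrightarrow> (\<forall>z\<in>insert T M. forces G V z coded \<longrightarrow> z \<in> V n)"
    proof (intro iffI ballI allI impI)
      fix z assume "\<forall>z. (y, z) \<in> acc G \<longrightarrow> forces G V z coded \<longrightarrow> z \<in> V n"
        "z \<in> insert T M" "forces G V z coded"
      then show "z \<in> V n" using acc_to_middle[OF y(2)] acc_top[OF N_world[OF y(2)]] by blast
    next
      fix z assume z: "\<forall>z\<in>insert T M. forces G V z coded \<longrightarrow> z \<in> V n" "(y, z) \<in> acc G" "forces G V z coded"
      have "z \<notin> N" using low[OF x acc_trans[OF y(1) z(2)]] z(3) by blast
      then show "z \<in> V n" using z acc_worlds[OF z(2)] by (auto simp: worlds_eq)
    qed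
    finally show ?thesis .
  qed
  show "\<not> forces G U y coded"
    if x: "x \<in> N" "\<not> forces G U x coded" and y: "(x, y) \<in> acc G" "y \<in> N" for x y
  proof -
    define Z where "Z p q \<longleftrightarrow> p = q \<or> p \<in> N \<and> q \<in> N \<and> (x, p) \<in> acc G \<and> (x, q) \<in> acc G" for p q
    have step: "\<exists>q'. (q, q') \<in> acc G \<and> Z p' q'" if Z: "Z p q" and p': "(p, p') \<in> acc G" for p q p'
    proof (cases "p = q")
      case True
      then show ?thesis using p' unfolding Z_def by blast
    next
      case False
      then have pq: "p \<in> N" "q \<in> N" "(x, p) \<in> acc G" "(x, q) \<in> acc G" using Z unfolding Z_def by blast+
      show ?thesis
      proof (cases "p' \<in> N")
        case True
        then show ?thesis using pq acc_trans[OF pq(3) p'] acc_refl[OF N_world[OF pq(2)]]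
          unfolding Z_def by blast
      next
        case False
        then have "(q, p') \<in> acc G"
          using acc_worlds[OF p'] acc_to_middle[OF pq(2)] acc_top[OF N_world[OF pq(2)]]
          by (auto simp: worlds_eq)
        then show ?thesis unfolding Z_def by blast
      qed
    qed
    have "forces G U x coded \<longleftrightarrow> forces G U y coded"
    proof (rule forces_bisim[where Z = Z and X = UNIV])
      fix p q n assume "Z p q"
      then show "p \<in> U n \<longleftrightarrow> q \<in> U n" unfolding Z_def using above_iff[OF x] by blast
    next
      fix p q q' assume "Z p q" "(q, q') \<in> acc G"
      moreover have "Z b a" if "Z a b" for a b using that unfolding Z_def by blast
      ultimately show "\<exists>p'. (p, p') \<in> acc G \<and> Z p' q'" using step by blast
    next
      show "Z x y" using x(1) y N_world acc_refl unfolding Z_def by blast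
    qed (rule step, simp_all)
    then show ?thesis using x(2) by simp
  qed
  show "\<exists>z\<in>M. z \<notin> U 1" if x: "x \<in> N" "\<not> forces G U x coded" for x
  proof (rule ccontr)
    \<comment> \<open>If all middle points carried marker \<open>1\<close>, they and the low points
      above \<open>x\<close> would have the type of the top. For \<open>A\<close> the model above
      \<open>x\<close> would collapse to \<open>T\<close>, and \<open>x\<close> would force
      \<open>coded\<close>.\<close>
    assume all: "\<not> (\<exists>z\<in>M. z \<notin> U 1)"
    have xw: "x \<in> worlds G" using x N_world by blast
    have TB: "forces G U T coded" using topM by blast
    note T = TB[unfolded forces_coded[OF crown U T_world]]
    have M: "vtype U z = vtype U T \<and> z \<in> U 1 \<and> z \<in> U 4" if "z \<in> insert T M" for z
    proof -
      have "z \<in> worlds G" using that M_world by auto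
      moreover have "z \<in> U 1" using that all T by auto
      ultimately show ?thesis using topM[OF that] acc_refl unfolding forces_coded[OF crown U \<open>z \<in> worlds G\<close>] by blast
    qed
    have lowU: "y \<in> U n" if "(x, y) \<in> acc G" "y \<in> N" "\<And>z. z \<in> insert T M \<Longrightarrow> z \<in> U n" for y n
      unfolding above_iff[OF x that(1,2)] using that(3) agree M_world T_world by blast
    have up: "vtype U z = vtype U T \<and> z \<in> U 1 \<and> z \<in> U 4" if z: "(x, z) \<in> acc G" for z
    proof (cases "z \<in> N")
      case True
      have "z \<in> U (3 * p)" if p: "p \<in> vars A" "T \<in> U (3 * p)" for p
      proof (rule lowU[OF z True])
        fix w assume "w \<in> insert T M"
        then have "vtype U w = vtype U T" using M by blast
        moreover have "p \<in> vtype U T" using p by (simp add: vtype_def)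
        ultimately have "p \<in> vtype U w" by blast
        then show "w \<in> U (3 * p)" by (simp add: vtype_def)
      qed
      moreover have "T \<in> U (3 * p)" if "z \<in> U (3 * p)" for p
        using that mono[OF U] acc_top[OF N_world[OF True]] by blast
      ultimately have "vtype U z = vtype U T" unfolding vtype_def by blast
      moreover have "z \<in> U 1" by (rule lowU[OF z True]) (use M in blast)
      moreover have "z \<in> U 4" by (rule lowU[OF z True]) (use M in blast)
      ultimately show ?thesis by blast
    next
      case False
      then have "z \<in> insert T M" using acc_worlds[OF z] by (auto simp: worlds_eq)
      then show ?thesis by (rule M)
    qed
    have "forces G (\<lambda>p. U (3 * p)) x A \<longleftrightarrow> forces G (\<lambda>p. U (3 * p)) T A"
    proof (rule forces_bisim[where Z = "\<lambda>p q. (x, p) \<in> acc G \<and> q = T" and X = "vars A"])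
      fix p q n assume "(x, p) \<in> acc G \<and> q = T" "n \<in> vars A"
      then have "n \<in> vtype U p \<longleftrightarrow> n \<in> vtype U q" using up by blast
      then show "p \<in> U (3 * n) \<longleftrightarrow> q \<in> U (3 * n)" using \<open>n \<in> vars A\<close> by (simp add: vtype_def)
    next
      fix p q p' assume "(x, p) \<in> acc G \<and> q = T" "(p, p') \<in> acc G"
      then show "\<exists>q'. (q, q') \<in> acc G \<and> (x, p') \<in> acc G \<and> q' = T"
        using acc_trans acc_refl[OF T_world] by blast
    next
      fix p q q' assume "(x, p) \<in> acc G \<and> q = T" "(q, q') \<in> acc G"
      then show "\<exists>p'. (p, p') \<in> acc G \<and> (x, p') \<in> acc G \<and> q' = T"
        using acc_from_top acc_refl acc_worlds by blast
    qed (use acc_refl[OF xw] in simp_all)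
    moreover have "vtype U T \<in> permitted U T" "good (vtype U T) (permitted U T)"
      "forces G (\<lambda>p. U (3 * p)) T A" "T \<in> U 1"
      using T acc_refl[OF T_world] by blast+
    moreover have "vtype U z \<in> permitted U T" if "(x, z) \<in> acc G" for z
      using up[OF that] \<open>vtype U T \<in> permitted U T\<close> by simp
    ultimately have "forces G U x coded"
      unfolding forces_coded[OF crown U xw] using up by (intro conjI allI impI) blast+
    then show False using x(2) by simp
  qed
qed

text \<open>Only low points are left to mend. The failing ones jointly receive the root type that
  belongs to the middle types, so \<open>extends\<close> gives \<open>A\<close>; a middle point with
  marker \<open>4\<close> but not \<open>1\<close> accounts for their missing markers.\<close>

lemma repair_low:
  defines "U \<equiv> eval_subst G V repair_low"
  assumes top: "\<And>z. z \<in> insert T M \<Longrightarrow> forces G V z coded"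
    and low: "\<And>x y. x \<in> N \<Longrightarrow> \<not> forces G V x coded \<Longrightarrow> (x, y) \<in> acc G \<Longrightarrow> y \<in> N \<Longrightarrow>
      \<not> forces G V y coded"
    and middle: "\<And>x. x \<in> N \<Longrightarrow> \<not> forces G V x coded \<Longrightarrow> \<exists>z\<in>M. z \<notin> V 1"
  shows "x \<in> worlds G \<Longrightarrow> forces G V x coded \<Longrightarrow> x \<in> U n \<longleftrightarrow> x \<in> V n"
    and "x \<in> worlds G \<Longrightarrow> forces G U x coded"
proof -
  have U: "valuation_on G U" unfolding U_def by (rule valuation_eval_subst[OF V])
  define t where "t = vtype V T"
  \<comment> \<open>Middle points with marker \<open>1\<close> are invisible to
    \<open>no_middle\<close>, but they have type \<open>t\<close>, so \<open>insert t Y\<close>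
    still covers all middle types.\<close>
  define Y where "Y = vtype V ` {z \<in> M. z \<notin> V 1}"
  have Y_sub: "Y \<subseteq> Pow (vars A)" and t_sub: "t \<subseteq> vars A"
    using vtype_subset by (auto simp: Y_def t_def)
  have TB: "T \<in> V 1" "good t (permitted V T)"
    using top[of T] unfolding forces_coded[OF crown V T_world] t_def by blast+
  have MB: "(z \<in> V 1 \<longrightarrow> vtype V z = t) \<and> z \<in> V 4 \<and> vtype V z \<in> permitted V T" if z: "z \<in> M" for z
  proof -
    have zw: "z \<in> worlds G" by (rule M_world[OF z])
    have b: "forces G V z coded" using top z by blast
    note b = b[unfolded forces_coded[OF crown V zw]]
    have "z \<in> V 4"
    proof (rule ccontr)
      assume "z \<notin> V 4"
      then obtain w where "(z, w) \<in> acc G" "w \<in> V 4" "w \<notin> V 1" using b acc_refl[OF zw] by blast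
      then show False using acc_from_middle[OF z] \<open>z \<notin> V 4\<close> TB(1) by blast
    qed
    then show ?thesis using b acc_refl[OF zw] unfolding t_def by blast
  qed
  have ext: "extends t Y (root t Y)"
  proof -
    have "Y \<subseteq> permitted V T" using MB by (auto simp: Y_def)
    then show ?thesis using TB(2) unfolding good_def root_def by (metis someI_ex)
  qed
  have no_middle: "forces G V w (no_middle y) \<longleftrightarrow> y \<notin> Y"
    if w: "w \<in> N" "\<not> forces G V w coded" and y: "y \<subseteq> vars A" for w y
  proof -
    have "forces G V w (no_middle y) \<longleftrightarrow> (\<forall>z. (w, z) \<in> acc G \<longrightarrow>
        forces G V z coded \<and> z \<in> V 4 \<and> forces G V z (Conj ((\<lambda>p. Var (3 * p)) ` y)) \<longrightarrow>
        z \<in> V 1 \<or> forces G V z (Disj ((\<lambda>p. Var (3 * p)) ` (vars A - y))))"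
      by (simp add: no_middle_def)
    also have "\<dots> \<longleftrightarrow> (\<forall>z. (w, z) \<in> acc G \<longrightarrow> forces G V z coded \<longrightarrow> z \<in> V 4 \<longrightarrow>
        vtype V z = y \<longrightarrow> z \<in> V 1)"
      using forces_exact_type[OF y, of G V] by blast
    also have "\<dots> \<longleftrightarrow> (\<forall>z\<in>M. vtype V z = y \<longrightarrow> z \<in> V 1)"
    proof (intro iffI ballI allI impI)
      fix z assume "\<forall>z. (w, z) \<in> acc G \<longrightarrow> forces G V z coded \<longrightarrow> z \<in> V 4 \<longrightarrow> vtype V z = y \<longrightarrow> z \<in> V 1"
        "z \<in> M" "vtype V z = y"
      then show "z \<in> V 1" using acc_to_middle[OF w(1)] top MB by blast
    next
      fix z assume z: "\<forall>z\<in>M. vtype V z = y \<longrightarrow> z \<in> V 1" "(w, z) \<in> acc G" "forces G V z coded" "vtype V z = y"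
      have "z \<notin> N" using low[OF w z(2)] z(3) by blast
      then show "z \<in> V 1" using z acc_worlds[OF z(2)] TB(1) by (auto simp: worlds_eq)
    qed
    finally show ?thesis by (auto simp: Y_def)
  qed
  have in_root_iff: "forces G V x (in_root p) \<longleftrightarrow>
      (\<forall>t' Y'. t' \<subseteq> vars A \<longrightarrow> Y' \<subseteq> Pow (vars A) \<longrightarrow> p \<notin> root t' Y' \<longrightarrow>
        (\<forall>w. (x, w) \<in> acc G \<longrightarrow> t = t' \<longrightarrow> (\<forall>y\<in>Pow (vars A) - Y'. forces G V w (no_middle y)) \<longrightarrow>
           forces G V w coded \<or> (\<exists>y\<in>Y'. forces G V w (no_middle y))))" for x p
  proof -
    have *: "forces G V x (Imp (And (top_type t') (Conj (no_middle ` (Pow (vars A) - Y'))))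
         (Or coded (Disj (no_middle ` Y')))) \<longleftrightarrow>
       (\<forall>w. (x, w) \<in> acc G \<longrightarrow> t = t' \<longrightarrow> (\<forall>y\<in>Pow (vars A) - Y'. forces G V w (no_middle y)) \<longrightarrow>
           forces G V w coded \<or> (\<exists>y\<in>Y'. forces G V w (no_middle y)))"
      if "t' \<subseteq> vars A" "Y' \<subseteq> Pow (vars A)" for t' Y'
      using that finite_subset_Pow_vars[OF that(2)] forces_top_type[OF crown V that(1)] acc_worlds
      by (auto simp: forces_Conj forces_Disj t_def)
    have "forces G V x (in_root p) \<longleftrightarrow> (\<forall>t' Y'. t' \<subseteq> vars A \<longrightarrow> Y' \<subseteq> Pow (vars A) \<longrightarrow>
        p \<notin> root t' Y' \<longrightarrow> forces G V x (Imp (And (top_type t')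
          (Conj (no_middle ` (Pow (vars A) - Y')))) (Or coded (Disj (no_middle ` Y')))))"
      unfolding in_root_def by (auto simp: forces_Conj simp del: forces.simps(5))
    then show ?thesis by (simp only: * cong: imp_cong)
  qed
  have in_root: "forces G V x (in_root p) \<longleftrightarrow> p \<in> root t Y"
    if x: "x \<in> N" "\<not> forces G V x coded" for x p
  proof
    assume L: "forces G V x (in_root p)"
    show "p \<in> root t Y"
    proof (rule ccontr)
      assume "p \<notin> root t Y"
      then have "(\<forall>y\<in>Pow (vars A) - Y. forces G V x (no_middle y)) \<longrightarrow>
           forces G V x coded \<or> (\<exists>y\<in>Y. forces G V x (no_middle y))"
        using L[unfolded in_root_iff] t_sub Y_sub acc_refl[OF N_world[OF x(1)]] by blast
      then show False using no_middle[OF x] x(2) Y_sub by blast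
    qed
  next
    assume R: "p \<in> root t Y"
    show "forces G V x (in_root p)"
      unfolding in_root_iff
    proof (intro allI impI, rule ccontr)
      fix t' Y' w
      assume Y': "Y' \<subseteq> Pow (vars A)" and p: "p \<notin> root t' Y'" and w: "(x, w) \<in> acc G" and t: "t = t'"
        and no: "\<forall>y\<in>Pow (vars A) - Y'. forces G V w (no_middle y)"
        and n: "\<not> (forces G V w coded \<or> (\<exists>y\<in>Y'. forces G V w (no_middle y)))"
      have wN: "w \<in> N" using n acc_worlds[OF w] top by (auto simp: worlds_eq)
      have nm: "forces G V w (no_middle y) \<longleftrightarrow> y \<notin> Y" if "y \<subseteq> vars A" for y
        using no_middle[OF wN _ that] n by blast
      have "Y = Y'"
      proof (intro equalityI subsetI)
        show "y \<in> Y'" if "y \<in> Y" for y using that no nm Y_sub by blast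
        show "y \<in> Y" if "y \<in> Y'" for y using that n nm Y' by blast
      qed
      then show False using p R t by simp
    qed
  qed
  have U_V: "x \<in> U n \<longleftrightarrow> x \<in> worlds G \<and> forces G V x (repair_low n)" for x n
    by (simp add: U_def eval_subst_def)
  show agree: "x \<in> U n \<longleftrightarrow> x \<in> V n" if x: "x \<in> worlds G" "forces G V x coded" for x n
  proof -
    have "forces G V w coded" if "(x, w) \<in> acc G" for w by (rule forces_mono[OF V x(2) that])
    then have "forces G V x (in_root p)" for p unfolding in_root_iff by blast
    moreover have "forces G V x (Imp coded (Var n)) \<longleftrightarrow> x \<in> V n"
      using x acc_refl[OF x(1)] V by (auto simp: valuation_on_def)
    ultimately show ?thesis
      unfolding U_V repair_low_def using x by (simp del: forces.simps(5))
  qed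
  have U_low: "x \<notin> U 1" "x \<notin> U 4" "p \<in> vars A \<Longrightarrow> x \<in> U (3 * p) \<longleftrightarrow> p \<in> root t Y"
    if x: "x \<in> N" "\<not> forces G V x coded" for x p
  proof -
    show "x \<notin> U 1" "x \<notin> U 4" using x(2) by (simp_all add: U_V repair_low_def)
    assume p: "p \<in> vars A"
    have "3 * p \<noteq> 1" "3 * p \<noteq> 4" by presburger+
    then have "x \<in> U (3 * p) \<longleftrightarrow> forces G V x (Imp coded (Var (3 * p))) \<and> p \<in> root t Y"
      using p in_root[OF x] N_world[OF x(1)] by (simp add: U_V repair_low_def del: forces.simps(5))
    \<comment> \<open>The points above \<open>x\<close> that force \<open>coded\<close> are top and
      middle points, whose types contain the root type.\<close>
    moreover have "forces G V x (Imp coded (Var (3 * p)))" if r: "p \<in> root t Y"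
    proof -
      have "w \<in> V (3 * p)" if w: "(x, w) \<in> acc G" "forces G V w coded" for w
      proof -
        have "w \<notin> N" using low[OF x w(1)] w(2) by blast
        then consider "w = T" | "w \<in> M" using acc_worlds[OF w(1)] by (auto simp: worlds_eq)
        then have "p \<in> vtype V w"
        proof cases
          case 1
          then show ?thesis using r ext by (auto simp: extends_def t_def)
        next
          case 2
          then show ?thesis using r ext MB[OF 2] by (cases "w \<in> V 1") (auto simp: extends_def Y_def)
        qed
        then show ?thesis by (simp add: vtype_def)
      qed
      then show ?thesis by simp
    qed
    ultimately show "x \<in> U (3 * p) \<longleftrightarrow> p \<in> root t Y" by blast
  qed
  have U_B: "forces G U x coded" if x: "x \<in> worlds G" "forces G V x coded" for x
  proof -
    have "forces G U x coded \<longleftrightarrow> forces G V x coded"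
      by (rule forces_agree[OF _ x(1)]) (use agree acc_worlds forces_mono[OF V x(2)] in blast)
    then show ?thesis using x by simp
  qed
  have vtype_U: "vtype U z = vtype V z" if "z \<in> insert T M" for z
    using agree[OF _ top[OF that]] that M_world by (auto simp: vtype_def)
  have U14: "z \<in> U n \<longleftrightarrow> z \<in> V n" if "z \<in> insert T M" for z n
    using agree[OF _ top[OF that]] that M_world by auto
  have permitted_U: "permitted U T = permitted V T"
    using U14[of T] by (simp add: permitted_def)
  show "forces G U x coded" if xw: "x \<in> worlds G" for x
  proof (cases "forces G V x coded")
    case True
    then show ?thesis using U_B xw by blast
  next
    case False
    have x: "x \<in> N" using False top xw by (auto simp: worlds_eq)
    have forces_A: "forces G (\<lambda>p. U (3 * p)) x A"
    proof -
      have im: "insert t (vtype V ` M) = insert t Y"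
        using MB by (auto simp: Y_def)
      have "forces G (\<lambda>p. U (3 * p)) x A \<longleftrightarrow> forces G (glue T M N t (vtype V) (root t Y)) x A"
      proof (rule glue_bisim[OF crown crown refl x x])
        fix p assume p: "p \<in> vars A"
        show "T \<in> U (3 * p) \<longleftrightarrow> p \<in> t" using p U14[of T] by (simp add: t_def vtype_def)
        show "z \<in> U (3 * p) \<longleftrightarrow> p \<in> vtype V z" if "z \<in> M" for z
          using p U14[of z] that by (simp add: vtype_def)
        show "z \<in> U (3 * p) \<longleftrightarrow> p \<in> root t Y" if "z \<in> N" "(x, z) \<in> acc G" for z
          using U_low(3)[OF that(1) low[OF x False that(2,1)] p] .
      qed
      moreover have "forces G (glue T M N t (vtype V) (root t Y)) x A"
        using ext[unfolded extends_def] G crown im x by blast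
      ultimately show ?thesis by simp
    qed
    have up: "(z \<in> U 1 \<longrightarrow> vtype U z = vtype U T \<and> z \<in> U 4) \<and>
        (z \<notin> U 4 \<longrightarrow> (\<exists>w. (z, w) \<in> acc G \<and> w \<in> U 4 \<and> w \<notin> U 1)) \<and>
        (z \<in> U 4 \<longrightarrow> vtype U z \<in> permitted U T)" if z: "(x, z) \<in> acc G" for z
    proof (cases "z \<in> N")
      case True
      obtain w where "w \<in> M" "w \<notin> V 1" using middle[OF x False] by blast
      then have "(z, w) \<in> acc G" "w \<in> U 4" "w \<notin> U 1"
        using acc_to_middle True U14 MB by auto
      then show ?thesis using U_low(1,2)[OF True low[OF x False z True]] by blast
    next
      case False
      have zw: "z \<in> worlds G" using acc_worlds[OF z] by blast
      then have "forces G U z coded" using False top U_B by (auto simp: worlds_eq)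
      then show ?thesis unfolding forces_coded[OF crown U zw] using acc_refl[OF zw] by blast
    qed
    have "T \<in> U 1" "good (vtype U T) (permitted U T)"
      using TB U14[of T] vtype_U[of T] by (simp_all add: permitted_U t_def)
    then show ?thesis unfolding forces_coded[OF crown U xw] using forces_A up by (intro conjI allI impI) blast+
  qed
qed

end

section \<open>Projectivity of \<open>coded\<close> and the most general unifier\<close>

lemma coded_projective:
  assumes \<mu>: "unifier (logic \<F>) A \<mu>" and "\<F> \<noteq> {}"
  obtains \<delta> where "subst \<delta> coded \<in> logic \<F>" "\<And>n. Imp coded (Iff (\<delta> n) (Var n)) \<in> logic \<F>"
proof -
  obtain G0 T0 M0 N0 where G0: "G0 \<in> \<F>" "crown G0 T0 M0 N0" using assms(2) ex_crown by blast
  interpret G0: crown G0 T0 M0 N0 by (rule G0(2))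
  \<comment> \<open>The constant \<open>a\<close> for \<open>repair_top\<close> is read off at the
    top of a model evaluated through \<open>factor\<close>; the empty valuation is just a convenient
    start.\<close>
  define U0 where "U0 = eval_subst G0 (\<lambda>_. {}) (factor \<mu>)"
  define a where "a = {n. T0 \<in> U0 n}"
  have "valuation_on G0 (\<lambda>_. {})" by (simp add: valuation_on_def)
  then have U0: "forces G0 U0 T0 coded"
    unfolding U0_def using forces_factor_coded[OF \<mu> G0] by simp
  have const: "forces G U x coded"
    if "crown G T M N" and U: "\<And>z n. z \<in> worlds G \<Longrightarrow> z \<in> U n \<longleftrightarrow> n \<in> a" and x: "x \<in> worlds G"
    for G :: "'w frame" and T M N U x
  proof -
    interpret crown G T M N by fact
    have "forces G U x coded \<longleftrightarrow> forces G0 U0 T0 coded"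
    proof (rule forces_bisim[where Z = "\<lambda>p q. p \<in> worlds G \<and> q = T0" and X = UNIV])
      fix p q n assume "p \<in> worlds G \<and> q = T0"
      then show "p \<in> U n \<longleftrightarrow> q \<in> U0 n" using U by (simp add: a_def)
    qed (use x acc_worlds acc_refl G0.acc_from_top G0.acc_refl G0.T_world in blast)+
    then show ?thesis using U0 by simp
  qed
  \<comment> \<open>On models \<open>repair_top a\<close> acts first, and \<open>repair_low\<close>
    is evaluated in the result.\<close>
  define \<delta> where "\<delta> = subst_comp (repair_top a) repair_low"
  have main: "forces G (eval_subst G V \<delta>) x coded \<and>
      (forces G V x coded \<longrightarrow> (\<forall>n. x \<in> eval_subst G V \<delta> n \<longleftrightarrow> x \<in> V n))"
    if GF: "G \<in> \<F>" and V: "valuation_on G V" and x: "x \<in> worlds G" for G V x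
  proof -
    obtain T M N where crown: "crown G T M N" using ex_crown GF by blast
    interpret crown G T M N by (rule crown)
    define V1 where "V1 = eval_subst G V (repair_top a)"
    have V1: "valuation_on G V1" unfolding V1_def by (rule valuation_eval_subst[OF V])
    have eval: "eval_subst G V \<delta> = eval_subst G V1 repair_low"
    proof (intro ext set_eqI)
      fix n x
      show "x \<in> eval_subst G V \<delta> n \<longleftrightarrow> x \<in> eval_subst G V1 repair_low n"
        using forces_subst[of x V "repair_top a" "repair_low n", folded V1_def]
        unfolding eval_subst_def[of G V \<delta>] eval_subst_def[of G V1]
        by (auto simp: \<delta>_def subst_comp_def)
    qed
    have "\<forall>U. (\<forall>z\<in>worlds G. \<forall>n. z \<in> U n \<longleftrightarrow> n \<in> a) \<longrightarrow> (\<forall>x\<in>worlds G. forces G U x coded)"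
      using const[OF crown] by blast
    note top = repair_top[OF GF crown V this, folded V1_def]
    have "forces G (eval_subst G V1 repair_low) x coded"
      by (rule repair_low(2)[OF GF crown V1]) (use top x in blast)+
    moreover have "x \<in> eval_subst G V1 repair_low n \<longleftrightarrow> x \<in> V n" if xB: "forces G V x coded" for n
    proof -
      have "forces G V1 x coded \<longleftrightarrow> forces G V x coded"
        by (rule forces_agree[OF _ x]) (use top(1) acc_worlds forces_mono[OF V xB] in blast)
      then have "x \<in> eval_subst G V1 repair_low n \<longleftrightarrow> x \<in> V1 n"
        using xB by (intro repair_low(1)[OF GF crown V1]) (use top x in blast)+
      then show ?thesis using top(1)[OF x xB] by blast
    qed
    ultimately show ?thesis by (simp add: eval)
  qed
  show ?thesis
  proof
    show "subst \<delta> coded \<in> logic \<F>"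
      using main ex_crown crown.forces_subst by (fastforce simp: logic_def)
    show "Imp coded (Iff (\<delta> n) (Var n)) \<in> logic \<F>" for n
      unfolding logic_def
    proof (intro CollectI ballI allI impI)
      fix G V x assume G: "G \<in> \<F>" "valuation_on G V" "x \<in> worlds G"
      obtain T M N where crown: "crown G T M N" using ex_crown G by blast
      interpret crown G T M N by (rule crown)
      have "forces G V z (\<delta> n) \<longleftrightarrow> z \<in> V n" if "z \<in> worlds G" "forces G V z coded" for z
        using main[OF G(1,2) that(1)] that by (simp add: eval_subst_def)
      moreover have "forces G V w coded" if "forces G V z coded" "(z, w) \<in> acc G" for z w
        by (rule forces_mono[OF G(2) that])
      ultimately show "forces G V x (Imp coded (Iff (\<delta> n) (Var n)))"
        using acc_worlds by simp
    qed
  qed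
qed

text \<open>\<open>coded\<close> mentions no unifier, so \<delta> obtained from one unifier serves
  for all. Models evaluated through \<open>factor m\<close> force \<open>coded\<close>, hence
  \<delta> changes nothing there, and the variables \<open>3 * p\<close> give back
  \<open>m p\<close>.\<close>

lemma most_general_unifier:
  assumes "unifiable (logic \<F>) A" and "\<F> \<noteq> {}"
  shows "\<exists>e. unifier (logic \<F>) A e \<and>
    (\<forall>m. unifier (logic \<F>) A m \<longrightarrow> more_general (logic \<F>) e m)"
proof -
  obtain \<mu> where "unifier (logic \<F>) A \<mu>" using assms(1) by (auto simp: unifiable_def)
  then obtain \<delta> where \<delta>: "subst \<delta> coded \<in> logic \<F>" "\<And>n. Imp coded (Iff (\<delta> n) (Var n)) \<in> logic \<F>"
    using coded_projective assms(2) by blast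
  define e where "e = (\<lambda>p. \<delta> (3 * p))"
  have "subst \<delta> (subst (\<lambda>p. Var (3 * p)) C) = subst e C" for C
    by (induction C) (simp_all add: e_def)
  then have "unifier (logic \<F>) A e"
    using \<delta>(1) by (simp add: unifier_def logic_def coded_def)
  moreover have "more_general (logic \<F>) e m" if m: "unifier (logic \<F>) A m" for m
    unfolding more_general_def subst_eq_def
  proof (intro exI allI)
    fix p
    show "Iff (subst_comp (factor m) e p) (m p) \<in> logic \<F>"
      unfolding logic_def
    proof (intro CollectI ballI allI impI)
      fix G V x assume G: "G \<in> \<F>" and V: "valuation_on G V" and x: "x \<in> worlds G"
      obtain T M N where crown: "crown G T M N" using ex_crown G by blast
      interpret crown G T M N by (rule crown)
      have "forces G V y (subst (factor m) (\<delta> (3 * p))) \<longleftrightarrow> forces G V y (m p)"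
        if y: "y \<in> worlds G" for y
      proof -
        define U where "U = eval_subst G V (factor m)"
        have U: "valuation_on G U" unfolding U_def by (rule valuation_eval_subst[OF V])
        have "forces G U y coded" unfolding U_def by (rule forces_factor_coded[OF m G crown V y])
        then have "forces G U y (\<delta> (3 * p)) \<longleftrightarrow> y \<in> U (3 * p)"
          using in_logic_crown[OF \<delta>(2) G U y] acc_refl[OF y] by simp
        then show ?thesis
          using forces_subst[OF y] y by (simp add: U_def eval_subst_def factor_Var)
      qed
      then show "forces G V x (Iff (subst_comp (factor m) e p) (m p))"
        using acc_worlds by (simp add: subst_comp_def e_def)
    qed
  qed
  ultimately show ?thesis by blast
qed

end

theorem theorem4p9:
  fixes \<F> :: "'w frame set"
  assumes "\<F> \<subseteq> H_un"
  shows "unitary_unification (logic \<F>)"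
proof (cases "\<F> = {}")
  case True
  \<comment> \<open>Every formula is valid over the empty class, so any substitution is most
    general.\<close>
  then show ?thesis
    by (simp add: logic_def unitary_unification_def unifier_def more_general_def subst_eq_def)
next
  case False
  have "crown_class \<F>"
    using H_un_crown assms by unfold_locales blast
  then show ?thesis
    using crown_class.most_general_unifier False unfolding unitary_unification_def by blast
qed

end
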